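(* Assume that: (a) there exists $0<\delta<1$ such that for all $c\in[1-\delta,1+\delta]$ one can find numbers $c_1,c_2,c_3$ with $\varphi(cx)\le c_1\varphi(x)+c_2|x|+c_3$ for all real $x$; (b) the convex function $\varphi$ is differentiable; (c) there exists at least one $\phi$-projection $Q^*$ of $P$ on $M_g$ with the same support as $P$. Then: (1) there exists $\overline{\lambda}\in\mathbb{R}^{1+l}$ such that $$\varphi'\left(\frac{dQ^*}{dP}(x)\right)=\overline{\lambda}_0+\sum_{i=1}^{l}\overline{\lambda}_ig_i(x)\quad(P\text{-a.e.});$$ (2) the equality $$\inf_{Q\in M_g}\phi(Q,P)=\sup_{\lambda\in\mathbb{R}^{1+l}}\left\{\lambda_0-\int_{\mathcal{X}}\varphi^*\left(\lambda^Tg(x)\right)dP(x)\right\}$$ holds, and $\overline{\lambda}$ is a dual optimal solution, i.e. it attains the supremum on the right-hand side. Furthermore, if the function $\varphi$ is essentially smooth, then the dual optimal solution $\overline{\lambda}$ is unique.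
   Context: $(\mathcal{X},\mathcal{B})$ is a measurable space and $P$ a given probability measure on it. $\mathcal{M}$ is the real vector space of all signed finite measures on $(\mathcal{X},\mathcal{B})$, and $\mathcal{M}(P)$ the subspace of those absolutely continuous w.r.t. $P$. The function $\varphi:\mathbb{R}\to[0,+\infty]$ is proper, convex and closed, with $\varphi(1)=0$, and its domain $\{x:\varphi(x)<\infty\}$ is an interval with endpoints $a_\varphi<1<b_\varphi$ (finite or infinite). Closed means that $\varphi(x)\to\varphi(a_\varphi)$ as $x\downarrow a_\varphi$ if $a_\varphi$ is finite, and $\varphi(x)\to\varphi(b_\varphi)$ as $x\uparrow b_\varphi$ if $b_\varphi$ is finite (equivalently, $\varphi$ is lower semi-continuous). "Differentiable" means differentiable on $]a_\varphi,b_\varphi[$; then $\varphi'(a_\varphi)$ and $\varphi'(b_\varphi)$ denote the (finite or infinite) limits of $\varphi'(x)$ as $x\downarrow a_\varphi$ and $x\uparrow b_\varphi$. $\varphi$ is essentially smooth if it is differentiable with $\varphi'(a_\varphi)=-\infty$ when $a_\varphi>-\infty$ and $\varphi'(b_\varphi)=+\infty$ when $b_\varphi<+\infty$. The conjugate is $\varphi^*(t):=\sup_{x\in\mathbb{R}}\{tx-\varphi(x)\}$. For $Q\in\mathcal{M}(P)$ put $\phi(Q,P):=\int_{\mathcal{X}}\varphi\left(\frac{dQ}{dP}\right)dP$, and $\phi(Q,P):=+\infty$ if $Q\in\mathcal{M}\setminus\mathcal{M}(P)$. For $\Omega\subseteq\mathcal{M}$ with $\inf_{Q\in\Omega}\phi(Q,P)<\infty$,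 a $\phi$-projection of $P$ on $\Omega$ is a measure $Q^*\in\Omega$ such that $\phi(Q^*,P)\le\phi(Q,P)$ for all $Q\in\Omega$. $g_1,\ldots,g_l:\mathcal{X}\to\mathbb{R}$ are measurable functions, $g_0:=\mathbf{1}_{\mathcal{X}}$, $g:=(g_0,g_1,\ldots,g_l)^T$, and $g_0,\ldots,g_l$ are linearly independent in the sense that $P\{\lambda^Tg(x)\ne0\}>0$ for every nonzero $\lambda=(\lambda_0,\ldots,\lambda_l)\in\mathbb{R}^{1+l}$. $M_g$ is the set of all $Q\in\mathcal{M}(P)$ which integrate the $g_i$ (i.e. $\int|g_i|\,d|Q|<\infty$) and satisfy $Q(\mathcal{X})=1$ and $\int_{\mathcal{X}}g_i\,dQ=0$ for $i=1,\ldots,l$. A measure $Q\in\mathcal{M}(P)$ has the same support as $P$ if $\frac{dQ}{dP}\ne0$ ($P$-a.e.). *)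

theory Defs
  imports "HOL-Probability.Probability"
begin

section \<open>Finite signed measures\<close>

text \<open>
  A signed measure is a real-valued (hence finite) set function.  As for
  \<^typ>\<open>'a measure\<close>, its value off the \<open>\<sigma>\<close>-algebra is fixed to be 0.
\<close>

definition signed_measures :: "'a measure \<Rightarrow> ('a set \<Rightarrow> real) set" where
  "signed_measures M = {Q. Q {} = 0 \<and> (\<forall>A. A \<notin> sets M \<longrightarrow> Q A = 0) \<and>
     (\<forall>A :: nat \<Rightarrow> 'a set. range A \<subseteq> sets M \<longrightarrow> disjoint_family A \<longrightarrow>
        (\<lambda>n. Q (A n)) sums Q (\<Union>n. A n))}"

definition ac_signed_measures :: "'a measure \<Rightarrow> ('a set \<Rightarrow> real) set" where
  "ac_signed_measures P = {Q \<in> signed_measures P. \<forall>A \<in> null_sets P. Q A = 0}"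

definition signed_RN_deriv :: "'a measure \<Rightarrow> ('a set \<Rightarrow> real) \<Rightarrow> 'a \<Rightarrow> real" where
  "signed_RN_deriv P Q =
     (SOME f. integrable P f \<and> (\<forall>A \<in> sets P. Q A = (LINT x:A|P. f x)))"

text \<open>
  Jordan decomposition \<open>Q = Q\<^sup>+ - Q\<^sup>-\<close>: \<open>Q\<^sup>+(A)\<close> is the supremum of \<open>Q(B)\<close> over measurable
  \<open>B \<subseteq> A\<close>, and \<open>Q\<^sup>- = (-Q)\<^sup>+\<close>.  The truncation of negative values by \<^const>\<open>ennreal\<close> is
  harmless because \<open>B = {}\<close> contributes 0.
\<close>

definition pos_variation :: "'a measure \<Rightarrow> ('a set \<Rightarrow> real) \<Rightarrow> 'a measure" where
  "pos_variation M Q =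
     measure_of (space M) (sets M) (\<lambda>A. SUP B \<in> {B \<in> sets M. B \<subseteq> A}. ennreal (Q B))"

definition neg_variation :: "'a measure \<Rightarrow> ('a set \<Rightarrow> real) \<Rightarrow> 'a measure" where
  "neg_variation M Q = pos_variation M (\<lambda>A. - Q A)"

definition total_variation :: "'a measure \<Rightarrow> ('a set \<Rightarrow> real) \<Rightarrow> 'a measure" where
  "total_variation M Q = measure_of (space M) (sets M)
     (\<lambda>A. emeasure (pos_variation M Q) A + emeasure (neg_variation M Q) A)"

definition integrates :: "'a measure \<Rightarrow> ('a set \<Rightarrow> real) \<Rightarrow> ('a \<Rightarrow> real) \<Rightarrow> bool" where
  "integrates M Q f \<longleftrightarrow> (\<integral>\<^sup>+x. ennreal \<bar>f x\<bar> \<partial>total_variation M Q) < \<infinity>"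

definition signed_integral :: "'a measure \<Rightarrow> ('a set \<Rightarrow> real) \<Rightarrow> ('a \<Rightarrow> real) \<Rightarrow> real" where
  "signed_integral M Q f =
     (LINT x|pos_variation M Q. f x) - (LINT x|neg_variation M Q. f x)"


section \<open>Divergence functions\<close>

definition phi_dom :: "(real \<Rightarrow> ereal) \<Rightarrow> real set" where
  "phi_dom \<phi> = {x. \<phi> x < \<infinity>}"

definition left_end :: "(real \<Rightarrow> ereal) \<Rightarrow> ereal" where
  "left_end \<phi> = (INF x \<in> phi_dom \<phi>. ereal x)"

definition right_end :: "(real \<Rightarrow> ereal) \<Rightarrow> ereal" where
  "right_end \<phi> = (SUP x \<in> phi_dom \<phi>. ereal x)"

definition phi_convex :: "(real \<Rightarrow> ereal) \<Rightarrow> bool" where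
  "phi_convex \<phi> \<longleftrightarrow> (\<forall>x y t. 0 \<le> t \<longrightarrow> t \<le> 1 \<longrightarrow>
     \<phi> ((1 - t) * x + t * y) \<le> ereal (1 - t) * \<phi> x + ereal t * \<phi> y)"

definition phi_closed :: "(real \<Rightarrow> ereal) \<Rightarrow> bool" where
  "phi_closed \<phi> \<longleftrightarrow>
     (\<forall>a. left_end \<phi> = ereal a \<longrightarrow> (\<phi> \<longlongrightarrow> \<phi> a) (at_right a)) \<and>
     (\<forall>b. right_end \<phi> = ereal b \<longrightarrow> (\<phi> \<longlongrightarrow> \<phi> b) (at_left b))"

definition divergence_function :: "(real \<Rightarrow> ereal) \<Rightarrow> bool" where
  "divergence_function \<phi> \<longleftrightarrow>
     (\<forall>x. 0 \<le> \<phi> x) \<and> phi_dom \<phi> \<noteq> {} \<and> phi_convex \<phi> \<and> phi_closed \<phi> \<and> \<phi> 1 = 0 \<and>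
     is_interval (phi_dom \<phi>) \<and> left_end \<phi> < 1 \<and> 1 < right_end \<phi>"

definition phi_differentiable :: "(real \<Rightarrow> ereal) \<Rightarrow> bool" where
  "phi_differentiable \<phi> \<longleftrightarrow> (\<forall>x. left_end \<phi> < ereal x \<longrightarrow> ereal x < right_end \<phi> \<longrightarrow>
     (\<lambda>y. real_of_ereal (\<phi> y)) differentiable (at x))"

text \<open>
  The derivative, extended to the finite endpoints of the domain by its (possibly infinite)
  limits.  Its values outside the closure of the domain carry no meaning.
\<close>

definition phi_deriv :: "(real \<Rightarrow> ereal) \<Rightarrow> real \<Rightarrow> ereal" where
  "phi_deriv \<phi> x =
     (let D = (\<lambda>y. ereal (deriv (\<lambda>z. real_of_ereal (\<phi> z)) y)) in
      if ereal x = left_end \<phi> then Lim (at_right x) D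
      else if ereal x = right_end \<phi> then Lim (at_left x) D
      else D x)"

definition essentially_smooth :: "(real \<Rightarrow> ereal) \<Rightarrow> bool" where
  "essentially_smooth \<phi> \<longleftrightarrow> phi_differentiable \<phi> \<and>
     (\<forall>a. left_end \<phi> = ereal a \<longrightarrow> phi_deriv \<phi> a = - \<infinity>) \<and>
     (\<forall>b. right_end \<phi> = ereal b \<longrightarrow> phi_deriv \<phi> b = \<infinity>)"

definition conjugate :: "(real \<Rightarrow> ereal) \<Rightarrow> real \<Rightarrow> ereal" where
  "conjugate \<phi> t = (SUP x. ereal (t * x) - \<phi> x)"


section \<open>Divergences, projections and the dual problem\<close>

text \<open>
  Lebesgue integral of an extended-real function.  If both parts have infinite integral,
  the value is \<open>\<infinity> - \<infinity> = \<infinity>\<close> in \<^typ>\<open>ereal\<close>.  This does not happen for the dual objective as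
  soon as some \<open>Q \<in> M\<^sub>g\<close> has finite divergence: by Young's inequality
  \<open>\<phi>\<^sup>*(\<lambda>\<^sup>T g) \<ge> (\<lambda>\<^sup>T g) dQ/dP - \<phi>(dQ/dP)\<close>, and the right-hand side is \<open>P\<close>-integrable.
\<close>

definition ereal_integral :: "'a measure \<Rightarrow> ('a \<Rightarrow> ereal) \<Rightarrow> ereal" where
  "ereal_integral M f =
     enn2ereal (\<integral>\<^sup>+x. e2ennreal (f x) \<partial>M) - enn2ereal (\<integral>\<^sup>+x. e2ennreal (- f x) \<partial>M)"

definition phi_divergence ::
    "(real \<Rightarrow> ereal) \<Rightarrow> 'a measure \<Rightarrow> ('a set \<Rightarrow> real) \<Rightarrow> ereal" where
  "phi_divergence \<phi> P Q =
     (if Q \<in> ac_signed_measures P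
      then ereal_integral P (\<lambda>x. \<phi> (signed_RN_deriv P Q x)) else \<infinity>)"

definition is_phi_projection ::
    "(real \<Rightarrow> ereal) \<Rightarrow> 'a measure \<Rightarrow> ('a set \<Rightarrow> real) set \<Rightarrow> ('a set \<Rightarrow> real) \<Rightarrow> bool" where
  "is_phi_projection \<phi> P \<Omega> Q' \<longleftrightarrow>
     (INF Q \<in> \<Omega>. phi_divergence \<phi> P Q) < \<infinity> \<and> Q' \<in> \<Omega> \<and>
     (\<forall>Q \<in> \<Omega>. phi_divergence \<phi> P Q' \<le> phi_divergence \<phi> P Q)"

definition same_support :: "'a measure \<Rightarrow> ('a set \<Rightarrow> real) \<Rightarrow> bool" where
  "same_support P Q \<longleftrightarrow> Q \<in> ac_signed_measures P \<and> (AE x in P. signed_RN_deriv P Q x \<noteq> 0)"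

text \<open>
  \<open>g\<^sub>1, \<dots>, g\<^sub>l\<close> is a family over a finite type \<open>'l\<close>.  The index set \<open>{0, \<dots>, l}\<close> is
  \<^typ>\<open>'l option\<close>, with \<^const>\<open>None\<close> playing the role of 0; so \<open>\<real>\<^sup>1\<^sup>+\<^sup>l\<close> is
  \<^typ>\<open>real ^ ('l::finite option)\<close>.
\<close>

definition gvec :: "('l::finite \<Rightarrow> 'a \<Rightarrow> real) \<Rightarrow> 'a \<Rightarrow> real ^ 'l option" where
  "gvec g x = (\<chi> j. case j of None \<Rightarrow> 1 | Some i \<Rightarrow> g i x)"

definition M_set :: "'a measure \<Rightarrow> ('l::finite \<Rightarrow> 'a \<Rightarrow> real) \<Rightarrow> ('a set \<Rightarrow> real) set" where
  "M_set P g = {Q \<in> ac_signed_measures P.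
     (\<forall>i. integrates P Q (g i)) \<and> Q (space P) = 1 \<and> (\<forall>i. signed_integral P Q (g i) = 0)}"

definition dual_objective ::
    "(real \<Rightarrow> ereal) \<Rightarrow> 'a measure \<Rightarrow> ('l::finite \<Rightarrow> 'a \<Rightarrow> real) \<Rightarrow> real ^ 'l option \<Rightarrow> ereal" where
  "dual_objective \<phi> P g u =
     ereal (u $ None) - ereal_integral P (\<lambda>x. conjugate \<phi> (u \<bullet> gvec g x))"

definition dual_optimal ::
    "(real \<Rightarrow> ereal) \<Rightarrow> 'a measure \<Rightarrow> ('l::finite \<Rightarrow> 'a \<Rightarrow> real) \<Rightarrow> real ^ 'l option \<Rightarrow> bool" where
  "dual_optimal \<phi> P g u \<longleftrightarrow> dual_objective \<phi> P g u = (SUP v. dual_objective \<phi> P g v)"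

end

theory Submission
  imports Defs
begin

text \<open>
  Let \<open>q\<close> be the density of the projection \<open>Q\<^sup>*\<close>.  The theorem is the Lagrange multiplier rule,
  followed by an inspection of the equality case of Young's inequality.
  
  The growth condition makes dilations by factors near 1 harmless: they map the domain of \<open>\<phi>\<close>
  into itself, and \<open>\<phi>(c q)\<close> is integrable for every such factor \<open>c\<close>.  As \<open>q \<noteq> 0\<close>, it follows that \<open>q\<close> takes values in the
  interior of the domain almost everywhere, where \<open>\<phi>\<close> is differentiable
  (\<open>nonzero_dom_imp_interior\<close>).  It also follows that for uniformly small \<open>h\<close> with \<open>\<integral>q g\<^sub>j h dP = 0\<close> for
  all \<open>j\<close> the measure with density \<open>q (1 + h)\<close> lies in \<open>M\<^sub>g\<close> and has finite divergence
  (\<open>perturbation_optimal\<close>).  Minimality of \<open>Q\<^sup>*\<close> along \<open>q (1 + t h)\<close>, together with dominated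
  convergence of the convex difference quotients, gives \<open>\<integral>\<phi>'(q) q h dP = 0\<close>.  A function
  annihilated by the common annihilator of finitely many functions lies in their span
  (\<open>integrable_in_span_of_annihilator\<close>), so \<open>\<phi>'(q) q = \<lambda>\<^sup>T g q\<close> and, dividing by \<open>q\<close>,
  \<open>\<phi>'(q) = \<lambda>\<^sup>T g\<close> (\<open>slope_in_span\<close>).
  
  For the duality, Young's inequality \<open>\<phi>\<^sup>*(u\<^sup>T g) \<ge> u\<^sup>T g q - \<phi>(q)\<close> integrates to
  \<open>u\<^sub>0 - \<integral>\<phi>\<^sup>*(u\<^sup>T g) dP \<le> \<integral>\<phi>(q) dP\<close>, with equality exactly when the integrands agree almost
  everywhere, that is, when \<open>u\<^sup>T g = \<phi>'(q)\<close> (\<open>dual_attained_iff\<close>).  So \<open>\<lambda>\<close> is optimal with the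
  primal value, and any other optimal \<open>v\<close> has \<open>v\<^sup>T g = \<lambda>\<^sup>T g\<close> almost everywhere, whence \<open>v = \<lambda>\<close>
  by linear independence of the \<open>g\<^sub>j\<close>.
  
  Passing between set functions and densities requires the Radon-Nikodym theorem for signed set
  functions (\<open>signed_Radon_Nikodym\<close>) and the computation of the Jordan decomposition from a density
  (\<open>pos_variation_density\<close>).
\<close>

section \<open>Signed measures and their densities\<close>

lemma signed_measure_sums:
  assumes "Q \<in> signed_measures M" "range A \<subseteq> sets M" "disjoint_family A"
  shows "(\<lambda>n. Q (A n)) sums Q (\<Union>n. A n)"
  using assms by (auto simp: signed_measures_def)

lemma signed_measure_empty: "Q \<in> signed_measures M \<Longrightarrow> Q {} = 0"
  by (simp add: signed_measures_def)

lemma signed_measure_Un: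
  assumes Q: "Q \<in> signed_measures M" and A: "A \<in> sets M" and B: "B \<in> sets M"
    and disj: "A \<inter> B = {}"
  shows "Q (A \<union> B) = Q A + Q B"
proof -
  have "(\<lambda>n. Q (binaryset A B n)) sums Q (\<Union>n. binaryset A B n)"
  proof (rule signed_measure_sums[OF Q])
    show "range (binaryset A B) \<subseteq> sets M"
      using A B by (simp add: range_binaryset_eq)
    show "disjoint_family (binaryset A B)"
      using disj by (auto simp: disjoint_family_on_def binaryset_def)
  qed
  then show ?thesis
    using binaryset_sums[of Q A B] signed_measure_empty[OF Q]
    by (simp add: UN_binaryset_eq sums_unique2)
qed

lemma signed_measure_Diff:
  assumes Q: "Q \<in> signed_measures M" and A: "A \<in> sets M" and B: "B \<in> sets M"
    and sub: "B \<subseteq> A"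
  shows "Q (A - B) = Q A - Q B"
  using signed_measure_Un[OF Q, of B "A - B"] A B sub
  by (simp add: Un_absorb1 sets.Diff)

lemma signed_measure_uminus:
  assumes "Q \<in> signed_measures M"
  shows "(\<lambda>A. - Q A) \<in> signed_measures M"
  using assms by (auto simp: signed_measures_def intro!: sums_minus)

lemma ac_signed_measure_uminus:
  assumes "Q \<in> ac_signed_measures P"
  shows "(\<lambda>A. - Q A) \<in> ac_signed_measures P"
  using assms by (auto simp: ac_signed_measures_def intro!: signed_measure_uminus)

text \<open>
  The part of continuity from below that the boundedness argument uses: the increments of the
  sequence are disjoint, so their sum telescopes.
\<close>

lemma signed_measure_incseq_convergent:
  assumes Q: "Q \<in> signed_measures M" and sets: "\<And>n. G n \<in> sets M"
    and inc: "\<And>n. G n \<subseteq> G (Suc n)"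
  shows "convergent (\<lambda>n. Q (G n))"
proof -
  have "(\<lambda>n. Q (G (Suc n) - G n)) sums Q (\<Union>n. G (Suc n) - G n)"
    using sets disjoint_family_Suc[of G] inc
    by (intro signed_measure_sums[OF Q]) auto
  moreover have "(\<Sum>i<n. Q (G (Suc i) - G i)) = Q (G n) - Q (G 0)" for n
    using signed_measure_Diff[OF Q sets sets inc] by (simp add: sum_lessThan_telescope[of "\<lambda>n. Q (G n)"])
  ultimately have "(\<lambda>n. Q (G n) - Q (G 0)) \<longlonglongrightarrow> Q (\<Union>n. G (Suc n) - G n)"
    by (simp add: sums_def)
  then have "(\<lambda>n. Q (G n) - Q (G 0) + Q (G 0)) \<longlonglongrightarrow> Q (\<Union>n. G (Suc n) - G n) + Q (G 0)"
    by (intro tendsto_add) auto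
  then show ?thesis by (auto simp: convergent_def)
qed

text \<open>
  A finite-valued signed measure cannot be unbounded.  If \<open>Q\<close> is unbounded on the subsets of \<open>E\<close>,
  some \<open>B \<subseteq> E\<close> has \<open>\<bar>Q B\<bar>\<close> so large that both \<open>Q B\<close> and \<open>Q (E - B) = Q E - Q B\<close> are large,
  and \<open>Q\<close> is still unbounded on the subsets of one of the two.  Repeating this produces a
  decreasing sequence along which \<open>\<bar>Q\<bar>\<close> tends to infinity, against continuity from above.
\<close>

lemma signed_measure_bounded:
  assumes Q: "Q \<in> signed_measures M"
  shows "\<exists>K. \<forall>A \<in> sets M. \<bar>Q A\<bar> \<le> K"
proof (rule ccontr)
  define bad where
    "bad E \<longleftrightarrow> E \<in> sets M \<and> (\<forall>K. \<exists>B \<in> sets M. B \<subseteq> E \<and> \<bar>Q B\<bar> > K)" for E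
  assume "\<not> (\<exists>K. \<forall>A \<in> sets M. \<bar>Q A\<bar> \<le> K)"
  then have "\<exists>B \<in> sets M. \<bar>Q B\<bar> > K" for K
    by (simp add: not_le)
  then have bad_space: "bad (space M)"
    using sets.sets_into_space[of _ M] by (simp add: bad_def)
  have bad_shrink: "\<exists>F. bad F \<and> F \<subseteq> E \<and> \<bar>Q F\<bar> \<ge> K" if bad_E: "bad E" for E K
  proof -
    have E: "E \<in> sets M" using bad_E by (simp add: bad_def)
    obtain B where B: "B \<in> sets M" "B \<subseteq> E" "\<bar>Q B\<bar> > \<bar>K\<bar> + \<bar>Q E\<bar>"
      using bad_E unfolding bad_def by blast
    have diff: "Q (E - B) = Q E - Q B"
      by (rule signed_measure_Diff[OF Q E B(1,2)])
    have "bad B \<or> bad (E - B)"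
    proof (rule ccontr)
      assume "\<not> (bad B \<or> bad (E - B))"
      then have "\<exists>K. \<forall>C \<in> sets M. C \<subseteq> B \<longrightarrow> \<bar>Q C\<bar> \<le> K"
        and "\<exists>K. \<forall>C \<in> sets M. C \<subseteq> E - B \<longrightarrow> \<bar>Q C\<bar> \<le> K"
        using B(1) E by (simp_all add: bad_def not_less)
      then obtain K1 K2 where
        K1: "\<And>C. C \<in> sets M \<Longrightarrow> C \<subseteq> B \<Longrightarrow> \<bar>Q C\<bar> \<le> K1" and
        K2: "\<And>C. C \<in> sets M \<Longrightarrow> C \<subseteq> E - B \<Longrightarrow> \<bar>Q C\<bar> \<le> K2"
        by metis
      obtain C where C: "C \<in> sets M" "C \<subseteq> E" "\<bar>Q C\<bar> > K1 + K2"
        using bad_E unfolding bad_def by blast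
      have "Q C = Q (C \<inter> B) + Q (C - B)"
        using signed_measure_Un[OF Q, of "C \<inter> B" "C - B"] C(1) B(1)
        by (simp add: Int_Diff_Un sets.Int sets.Diff Int_Diff_disjoint)
      moreover have "\<bar>Q (C \<inter> B)\<bar> \<le> K1" "\<bar>Q (C - B)\<bar> \<le> K2"
        using C B K1[of "C \<inter> B"] K2[of "C - B"] by (auto simp: not_less)
      ultimately show False using C(3) by linarith
    qed
    then show ?thesis
    proof
      assume "bad B"
      moreover have "\<bar>Q B\<bar> \<ge> K" using B(3) by linarith
      ultimately show ?thesis using B(2) by blast
    next
      assume "bad (E - B)"
      moreover have "\<bar>Q (E - B)\<bar> \<ge> K" using B(3) diff by linarith
      ultimately show ?thesis by blast
    qed
  qed
  obtain F where F0: "bad (F 0)" and F: "\<And>n. bad (F n)" "\<And>n. F (Suc n) \<subseteq> F n"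
      "\<And>n. \<bar>Q (F (Suc n))\<bar> \<ge> real n"
  proof -
    have "\<exists>F. \<forall>n. bad (F n) \<and> (F (Suc n) \<subseteq> F n \<and> \<bar>Q (F (Suc n))\<bar> \<ge> real n)"
      by (rule dependent_nat_choice) (use bad_space bad_shrink in auto)
    then show ?thesis using that by blast
  qed
  have F_sets: "F n \<in> sets M" for n using F(1) by (simp add: bad_def)
  have F_sub: "F n \<subseteq> F 0" for n
    by (induction n) (use F(2) in auto)
  have "convergent (\<lambda>n. Q (F 0 - F n))"
    by (rule signed_measure_incseq_convergent[OF Q]) (use F(2) F_sets in auto)
  then have "Bseq (\<lambda>n. Q (F 0 - F n))" by (rule convergent_imp_Bseq)
  then obtain K where K: "\<And>n. \<bar>Q (F 0 - F n)\<bar> \<le> K"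
    by (auto simp: Bseq_def)
  have "real n \<le> K + \<bar>Q (F 0)\<bar>" for n
    using F(3)[of n] K[of "Suc n"] signed_measure_Diff[OF Q F_sets F_sets F_sub, of "Suc n"]
    by linarith
  then show False
    using reals_Archimedean2 not_less by blast
qed

text \<open>
  The set function underlying the positive part of the Jordan decomposition; whether it is a
  measure is a separate question, settled below.
\<close>

definition upper_variation :: "'a measure \<Rightarrow> ('a set \<Rightarrow> real) \<Rightarrow> 'a set \<Rightarrow> ennreal" where
  "upper_variation M Q A = (SUP B \<in> {B \<in> sets M. B \<subseteq> A}. ennreal (Q B))"

lemma upper_variation_upper:
  "B \<in> sets M \<Longrightarrow> B \<subseteq> A \<Longrightarrow> ennreal (Q B) \<le> upper_variation M Q A"
  unfolding upper_variation_def by (intro SUP_upper) auto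

lemma upper_variation_mono:
  "A \<subseteq> B \<Longrightarrow> upper_variation M Q A \<le> upper_variation M Q B"
  unfolding upper_variation_def by (intro SUP_subset_mono) auto

text \<open>
  Competitors for \<open>A\<close> and for \<open>B\<close> can be joined.  The case distinction in the proof is due to
  the truncation by \<^const>\<open>ennreal\<close>: a competitor of negative value is dropped instead.
\<close>

lemma upper_variation_superadditive:
  assumes Q: "Q \<in> signed_measures M" and disj: "A \<inter> B = {}"
  shows "upper_variation M Q A + upper_variation M Q B \<le> upper_variation M Q (A \<union> B)"
proof -
  let ?S = "\<lambda>A. {B \<in> sets M. B \<subseteq> A}"
  have *: "ennreal (Q C) + ennreal (Q D) \<le> upper_variation M Q (A \<union> B)"
    if C: "C \<in> ?S A" and D: "D \<in> ?S B" for C D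
  proof (cases "Q C \<le> 0 \<or> Q D \<le> 0")
    case True
    have "ennreal (Q C) \<le> upper_variation M Q (A \<union> B)"
         "ennreal (Q D) \<le> upper_variation M Q (A \<union> B)"
      using C D by (auto intro!: upper_variation_upper)
    then show ?thesis
      using True by (auto simp: ennreal_neg)
  next
    case False
    have "C \<inter> D = {}" using C D disj by blast
    then have "Q (C \<union> D) = Q C + Q D"
      using signed_measure_Un[OF Q, of C D] C D by simp
    then have "ennreal (Q C) + ennreal (Q D) = ennreal (Q (C \<union> D))"
      using False by simp
    also have "\<dots> \<le> upper_variation M Q (A \<union> B)"
      using C D by (intro upper_variation_upper) auto
    finally show ?thesis .
  qed
  have ne: "?S A \<noteq> {}" for A by blast
  have "upper_variation M Q A + upper_variation M Q B
      = (SUP C \<in> ?S A. SUP D \<in> ?S B. ennreal (Q C) + ennreal (Q D))"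
    unfolding upper_variation_def
    by (subst ennreal_SUP_add_left[OF ne, symmetric]) (simp only: ennreal_SUP_add_right[OF ne])
  also have "\<dots> \<le> upper_variation M Q (A \<union> B)"
    by (intro SUP_least *) auto
  finally show ?thesis .
qed

text \<open>
  Superadditivity gives one inequality.  For the other, a set \<open>B\<close> inside a disjoint union is cut
  along the union, and countable additivity of \<open>Q\<close> applies to the pieces.
\<close>

lemma upper_variation_countably_additive:
  assumes Q: "Q \<in> signed_measures M"
  shows "countably_additive (sets M) (upper_variation M Q)"
proof (rule countably_additiveI)
  fix A :: "nat \<Rightarrow> 'a set"
  assume A: "range A \<subseteq> sets M" "disjoint_family A"
  have fin: "(\<Sum>i<n. upper_variation M Q (A i)) \<le> upper_variation M Q (\<Union>i<n. A i)" for n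
  proof (induction n)
    case (Suc n)
    have "(\<Union>i<n. A i) \<inter> A n = {}"
      using A(2) unfolding disjoint_family_on_def by (auto simp: disjoint_iff) (metis less_irrefl)
    note sup = upper_variation_superadditive[OF Q this]
    have "(\<Sum>i<Suc n. upper_variation M Q (A i))
        \<le> upper_variation M Q (\<Union>i<n. A i) + upper_variation M Q (A n)"
      using Suc by (simp add: add_right_mono)
    also note sup
    also have "(\<Union>i<n. A i) \<union> A n = (\<Union>i<Suc n. A i)"
      by (auto simp: less_Suc_eq)
    finally show ?case .
  qed simp
  have le: "(\<Sum>i. upper_variation M Q (A i)) \<le> upper_variation M Q (\<Union>i. A i)"
    by (intro suminf_le_const order_trans[OF fin upper_variation_mono]) auto
  have ge: "upper_variation M Q (\<Union>i. A i) \<le> (\<Sum>i. upper_variation M Q (A i))"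
    unfolding upper_variation_def[of M Q "\<Union>i. A i"]
  proof (rule SUP_least)
    fix B assume "B \<in> {B \<in> sets M. B \<subseteq> (\<Union>i. A i)}"
    then have B: "B \<in> sets M" "B \<subseteq> (\<Union>i. A i)" by auto
    have "(\<lambda>n. Q (B \<inter> A n)) sums Q (\<Union>n. B \<inter> A n)"
      using A B by (intro signed_measure_sums[OF Q]) (auto simp: disjoint_family_on_def)
    also have "(\<Union>n. B \<inter> A n) = B" using B(2) by blast
    finally have "(\<lambda>n. ennreal (\<Sum>i<n. Q (B \<inter> A i))) \<longlonglongrightarrow> ennreal (Q B)"
      unfolding sums_def by (rule tendsto_ennrealI)
    then show "ennreal (Q B) \<le> (\<Sum>i. upper_variation M Q (A i))"
    proof (rule LIMSEQ_le_const2, intro exI allI impI)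
      fix n
      have "ennreal (\<Sum>i<n. Q (B \<inter> A i)) \<le> ennreal (\<Sum>i<n. max 0 (Q (B \<inter> A i)))"
        by (intro ennreal_leI sum_mono) simp
      also have "\<dots> = (\<Sum>i<n. ennreal (max 0 (Q (B \<inter> A i))))"
        by (rule sum_ennreal[symmetric]) simp
      also have "\<dots> = (\<Sum>i<n. ennreal (Q (B \<inter> A i)))"
        by (rule sum.cong) (auto simp: max_def ennreal_neg)
      also have "\<dots> \<le> (\<Sum>i<n. upper_variation M Q (A i))"
        using A(1) B(1) by (intro sum_mono upper_variation_upper) auto
      also have "\<dots> \<le> (\<Sum>i. upper_variation M Q (A i))"
        by (intro sum_le_suminf) auto
      finally show "ennreal (\<Sum>i<n. Q (B \<inter> A i)) \<le> (\<Sum>i. upper_variation M Q (A i))" .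
    qed
  qed
  show "(\<Sum>i. upper_variation M Q (A i)) = upper_variation M Q (\<Union>i. A i)"
    using le ge by (rule antisym)
qed

lemma sets_pos_variation [simp]: "sets (pos_variation M Q) = sets M"
  and space_pos_variation [simp]: "space (pos_variation M Q) = space M"
  by (simp_all add: pos_variation_def)

lemma emeasure_pos_variation:
  assumes Q: "Q \<in> signed_measures M" and A: "A \<in> sets M"
  shows "emeasure (pos_variation M Q) A = upper_variation M Q A"
proof (rule emeasure_measure_of[of _ "space M" "sets M"])
  show "pos_variation M Q = measure_of (space M) (sets M) (upper_variation M Q)"
    by (simp add: pos_variation_def upper_variation_def[abs_def])
  show "positive (sets (pos_variation M Q)) (upper_variation M Q)"
    using signed_measure_empty[OF Q] by (simp add: positive_def upper_variation_def)
  show "countably_additive (sets (pos_variation M Q)) (upper_variation M Q)"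
    using upper_variation_countably_additive[OF Q] by simp
qed (use A sets.space_closed in auto)

text \<open>
  Boundedness of \<open>Q\<close> makes the positive variation a finite measure, and null sets of \<open>P\<close> are null
  for it because all their measurable subsets are; so the Radon-Nikodym theorem for positive
  measures provides a real density.
\<close>

lemma pos_variation_RN:
  assumes P: "finite_measure P" and Q: "Q \<in> ac_signed_measures P"
  shows "\<exists>f. integrable P f \<and> (\<forall>A \<in> sets P. 0 \<le> (LINT x:A|P. f x)) \<and>
    (\<forall>A \<in> sets P. ennreal (LINT x:A|P. f x) = upper_variation P Q A)"
proof -
  interpret P: finite_measure P by (rule P)
  have Qs: "Q \<in> signed_measures P" and null: "\<And>A. A \<in> null_sets P \<Longrightarrow> Q A = 0"
    using Q by (auto simp: ac_signed_measures_def)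
  let ?N = "pos_variation P Q"
  have ac: "absolutely_continuous P ?N"
    unfolding absolutely_continuous_def
  proof
    fix A assume A: "A \<in> null_sets P"
    have "upper_variation P Q A \<le> 0"
      unfolding upper_variation_def
      by (rule SUP_least) (use null_sets_subset[OF A] null in auto)
    then show "A \<in> null_sets ?N"
      using A by (auto simp: null_sets_def emeasure_pos_variation[OF Qs])
  qed
  obtain f where f[measurable]: "f \<in> borel_measurable P" and dens: "density P f = ?N"
    using P.Radon_Nikodym[OF ac] by auto
  obtain K where K: "\<And>A. A \<in> sets P \<Longrightarrow> \<bar>Q A\<bar> \<le> K"
    using signed_measure_bounded[OF Qs] by blast
  have "(\<integral>\<^sup>+x. f x \<partial>P) = emeasure ?N (space P)"
    by (simp add: dens[symmetric] emeasure_density cong: nn_integral_cong)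
  also have "\<dots> \<le> ennreal K"
    unfolding emeasure_pos_variation[OF Qs sets.top] upper_variation_def
    by (rule SUP_least) (auto intro!: ennreal_leI order_trans[OF abs_ge_self K])
  finally have "(\<integral>\<^sup>+x. f x \<partial>P) \<noteq> \<infinity>" by (auto simp: top_unique)
  then have fin: "AE x in P. f x \<noteq> \<infinity>" by (intro nn_integral_PInf_AE) auto
  let ?f = "\<lambda>x. enn2real (f x)"
  have int: "integrable P ?f"
  proof (rule integrableI_bounded)
    have "(\<integral>\<^sup>+x. ennreal (norm (?f x)) \<partial>P) = (\<integral>\<^sup>+x. f x \<partial>P)"
      by (rule nn_integral_cong_AE) (use fin in \<open>auto elim!: eventually_mono simp: less_top\<close>)
    then show "(\<integral>\<^sup>+x. ennreal (norm (?f x)) \<partial>P) < \<infinity>"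
      using \<open>(\<integral>\<^sup>+x. f x \<partial>P) \<noteq> \<infinity>\<close> by (simp add: less_top)
  qed simp
  have "ennreal (LINT x:A|P. ?f x) = upper_variation P Q A" if A[measurable]: "A \<in> sets P" for A
  proof -
    have "ennreal (LINT x:A|P. ?f x) = (\<integral>\<^sup>+x. ennreal (indicator A x * ?f x) \<partial>P)"
      unfolding set_lebesgue_integral_def real_scaleR_def
      by (subst nn_integral_eq_integral)
         (use integrable_mult_indicator[OF A int] in auto)
    also have "\<dots> = (\<integral>\<^sup>+x. f x * indicator A x \<partial>P)"
      by (rule nn_integral_cong_AE)
         (use fin in \<open>auto elim!: eventually_mono simp: less_top split: split_indicator\<close>)
    also have "\<dots> = emeasure ?N A"
      by (simp add: dens[symmetric] emeasure_density)
    finally show ?thesis by (simp add: emeasure_pos_variation[OF Qs A])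
  qed
  moreover have "0 \<le> (LINT x:A|P. ?f x)" for A
    unfolding set_lebesgue_integral_def by (intro integral_nonneg_AE) auto
  ultimately show ?thesis using int by blast
qed

text \<open>
  One half of \<open>Q = Q\<^sup>+ - Q\<^sup>-\<close>: every competitor \<open>B\<close> for \<open>Q\<^sup>+(A)\<close> has value
  \<open>Q B = Q A + (- Q (A - B))\<close>, where \<open>A - B\<close> competes for \<open>Q\<^sup>-(A)\<close>.  The other half is this one
  applied to \<open>- Q\<close>.
\<close>

lemma upper_variation_minus_le:
  assumes Q: "Q \<in> signed_measures M" and A: "A \<in> sets M"
    and n: "upper_variation M (\<lambda>B. - Q B) A = ennreal n" "0 \<le> n"
    and p: "upper_variation M Q A = ennreal p" "0 \<le> p"
  shows "p \<le> Q A + n"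
proof -
  have n': "- Q B \<le> n" if "B \<in> sets M" "B \<subseteq> A" for B
    using upper_variation_upper[OF that, of "\<lambda>B. - Q B"] n by (simp add: ennreal_le_iff)
  have "upper_variation M Q A \<le> ennreal (Q A + n)"
    unfolding upper_variation_def
  proof (rule SUP_least)
    fix B assume B: "B \<in> {B \<in> sets M. B \<subseteq> A}"
    then have "- Q (A - B) \<le> n" using A by (intro n') auto
    then show "ennreal (Q B) \<le> ennreal (Q A + n)"
      using signed_measure_Diff[OF Q A, of B] B by (intro ennreal_leI) auto
  qed
  moreover have "0 \<le> Q A + n" using n'[OF A] by simp
  ultimately show ?thesis using p by (simp add: ennreal_le_iff)
qed

text \<open>
  The densities of the two variations are subtracted.  This justifies the choice in the
  definition of \<^const>\<open>signed_RN_deriv\<close>.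
\<close>

theorem signed_Radon_Nikodym:
  assumes P: "finite_measure P" and Q: "Q \<in> ac_signed_measures P"
  shows "\<exists>f. integrable P f \<and> (\<forall>A \<in> sets P. Q A = (LINT x:A|P. f x))"
proof -
  have Qs: "Q \<in> signed_measures P" using Q by (simp add: ac_signed_measures_def)
  obtain f where f: "integrable P f" "\<And>A. A \<in> sets P \<Longrightarrow> 0 \<le> (LINT x:A|P. f x)"
      "\<And>A. A \<in> sets P \<Longrightarrow> upper_variation P Q A = ennreal (LINT x:A|P. f x)"
    using pos_variation_RN[OF P Q] by metis
  obtain h where h: "integrable P h" "\<And>A. A \<in> sets P \<Longrightarrow> 0 \<le> (LINT x:A|P. h x)"
      "\<And>A. A \<in> sets P \<Longrightarrow> upper_variation P (\<lambda>A. - Q A) A = ennreal (LINT x:A|P. h x)"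
    using pos_variation_RN[OF P ac_signed_measure_uminus[OF Q]] by metis
  have "Q A = (LINT x:A|P. f x - h x)" if A: "A \<in> sets P" for A
  proof -
    have "(LINT x:A|P. f x) \<le> Q A + (LINT x:A|P. h x)"
      using f h A by (intro upper_variation_minus_le[OF Qs A]) auto
    moreover have "(LINT x:A|P. h x) \<le> - Q A + (LINT x:A|P. f x)"
      using f h A by (intro upper_variation_minus_le[OF signed_measure_uminus[OF Qs] A]) auto
    moreover have "(LINT x:A|P. f x - h x) = (LINT x:A|P. f x) - (LINT x:A|P. h x)"
      by (rule set_integral_diff(2))
         (use integrable_mult_indicator[OF A f(1)] integrable_mult_indicator[OF A h(1)]
           in \<open>simp_all add: set_integrable_def\<close>)
    ultimately show ?thesis by linarith
  qed
  then show ?thesis using f(1) h(1) by (intro exI[of _ "\<lambda>x. f x - h x"]) auto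
qed

lemma signed_RN_deriv_props:
  assumes "finite_measure P" "Q \<in> ac_signed_measures P"
  shows "integrable P (signed_RN_deriv P Q)"
    and "A \<in> sets P \<Longrightarrow> Q A = (LINT x:A|P. signed_RN_deriv P Q x)"
  using someI_ex[OF signed_Radon_Nikodym[OF assms]]
  unfolding signed_RN_deriv_def by auto

text \<open>
  Set functions in \<^const>\<open>signed_measures\<close> vanish off the \<open>\<sigma>\<close>-algebra, hence the default value.
\<close>

definition indefinite_integral :: "'a measure \<Rightarrow> ('a \<Rightarrow> real) \<Rightarrow> 'a set \<Rightarrow> real" where
  "indefinite_integral P r A = (if A \<in> sets P then LINT x:A|P. r x else 0)"

lemma indefinite_integral_ac:
  assumes r: "integrable P r"
  shows "indefinite_integral P r \<in> ac_signed_measures P"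
  unfolding ac_signed_measures_def signed_measures_def
proof (intro CollectI conjI allI ballI impI)
  fix A :: "nat \<Rightarrow> 'a set"
  assume A: "range A \<subseteq> sets P" "disjoint_family A"
  then have U: "(\<Union>n. A n) \<in> sets P" by auto
  have "(\<lambda>n. LINT x:A n|P. r x) sums (LINT x:(\<Union>n. A n)|P. r x)"
    unfolding sums_def
  proof -
    have int: "set_integrable P B r" if "B \<in> sets P" for B
      using integrable_mult_indicator[OF that r] by (simp add: set_integrable_def)
    have "(\<lambda>n. LINT x:(\<Union>i<n. A i)|P. r x) \<longlonglongrightarrow> (LINT x:(\<Union>n. \<Union>i<n. A i)|P. r x)"
      using A by (intro set_integral_cont_up int) (auto simp: incseq_def intro: less_le_trans)
    also have "(\<Union>n. \<Union>i<n. A i) = (\<Union>n. A n)" by auto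
    also have "(\<lambda>n. LINT x:(\<Union>i<n. A i)|P. r x) = (\<lambda>n. \<Sum>i<n. LINT x:A i|P. r x)"
      using A by (intro ext set_integral_finite_Union int disjoint_family_on_mono[OF _ A(2)]) auto
    finally show "(\<lambda>n. \<Sum>i<n. LINT x:A i|P. r x) \<longlonglongrightarrow> (LINT x:(\<Union>n. A n)|P. r x)" .
  qed
  then show "(\<lambda>n. indefinite_integral P r (A n)) sums indefinite_integral P r (\<Union>n. A n)"
    using A(1) U by (simp add: indefinite_integral_def subset_eq)
next
  fix A assume A: "A \<in> null_sets P"
  have "AE x in P. indicator A x *\<^sub>R r x = 0"
    using AE_not_in[OF A] by (auto elim!: eventually_mono)
  then show "indefinite_integral P r A = 0"
    unfolding indefinite_integral_def set_lebesgue_integral_def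
    by (simp add: integral_eq_zero_AE)
qed (auto simp: indefinite_integral_def set_lebesgue_integral_def)

lemma indefinite_integral_RN_deriv:
  assumes P: "finite_measure P" and r: "integrable P r"
  shows "AE x in P. signed_RN_deriv P (indefinite_integral P r) x = r x"
  using signed_RN_deriv_props[OF P indefinite_integral_ac[OF r]] r
  by (intro density_unique_real) (auto simp: indefinite_integral_def)

text \<open>
  If \<open>Q\<close> has density \<open>r\<close>, the supremum over measurable \<open>B \<subseteq> A\<close> is reached by cutting \<open>A\<close> down
  to \<open>{r \<ge> 0}\<close>, which exhibits the positive variation as the measure with density
  \<open>max 0 r\<close> (\<^const>\<open>ennreal\<close> does the truncation).
\<close>

lemma pos_variation_density:
  assumes r: "integrable P r" and Q: "\<And>A. A \<in> sets P \<Longrightarrow> Q A = (LINT x:A|P. r x)"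
  shows "pos_variation P Q = density P (\<lambda>x. ennreal (r x))"
proof -
  have [measurable]: "r \<in> borel_measurable P" using r by auto
  let ?D = "density P (\<lambda>x. ennreal (r x))"
  have eq: "upper_variation P Q A = emeasure ?D A" if A[measurable]: "A \<in> sets P" for A
  proof (rule antisym)
    have nn: "ennreal (LINT x:B|P. max 0 (r x)) = emeasure ?D B"
      if B[measurable]: "B \<in> sets P" for B
    proof -
      have "ennreal (LINT x:B|P. max 0 (r x)) = (\<integral>\<^sup>+x. ennreal (indicator B x * max 0 (r x)) \<partial>P)"
        unfolding set_lebesgue_integral_def real_scaleR_def
        using integrable_mult_indicator[OF B integrable_max[OF integrable_zero r]]
        by (subst nn_integral_eq_integral) auto
      also have "\<dots> = (\<integral>\<^sup>+x. ennreal (r x) * indicator B x \<partial>P)"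
        by (rule nn_integral_cong) (auto split: split_indicator simp: max_def ennreal_neg)
      finally show ?thesis by (simp add: emeasure_density)
    qed
    show "upper_variation P Q A \<le> emeasure ?D A"
      unfolding upper_variation_def
    proof (rule SUP_least)
      fix B assume "B \<in> {B \<in> sets P. B \<subseteq> A}"
      then have B: "B \<in> sets P" "B \<subseteq> A" by auto
      have "(LINT x:B|P. r x) \<le> (LINT x:B|P. max 0 (r x))"
        using integrable_mult_indicator[OF B(1) r]
          integrable_mult_indicator[OF B(1) integrable_max[OF integrable_zero r]]
        by (intro set_integral_mono) (simp_all add: set_integrable_def)
      then have "ennreal (Q B) \<le> emeasure ?D B"
        using Q nn B by (metis ennreal_leI)
      also have "\<dots> \<le> emeasure ?D A" using B by (intro emeasure_mono) auto
      finally show "ennreal (Q B) \<le> emeasure ?D A" .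
    qed
    let ?B = "A \<inter> {x \<in> space P. 0 \<le> r x}"
    have B: "?B \<in> sets P" by measurable
    have "emeasure ?D A = (\<integral>\<^sup>+x. ennreal (r x) * indicator A x \<partial>P)"
      by (simp add: emeasure_density)
    also have "\<dots> = (\<integral>\<^sup>+x. ennreal (indicator ?B x * r x) \<partial>P)"
      by (rule nn_integral_cong) (auto split: split_indicator simp: ennreal_neg)
    also have "\<dots> = ennreal (LINT x:?B|P. r x)"
      unfolding set_lebesgue_integral_def real_scaleR_def
      by (rule nn_integral_eq_integral)
         (use integrable_mult_indicator[OF B r] in \<open>auto split: split_indicator\<close>)
    also have "\<dots> \<le> upper_variation P Q A"
      using upper_variation_upper[of ?B P A Q] B Q[OF B] by simp
    finally show "emeasure ?D A \<le> upper_variation P Q A" .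
  qed
  have "pos_variation P Q = measure_of (space ?D) (sets ?D) (emeasure ?D)"
    unfolding pos_variation_def space_density sets_density upper_variation_def[symmetric]
    by (rule measure_of_eq) (use sets.space_closed eq in \<open>auto simp: sets.sigma_sets_eq\<close>)
  then show ?thesis by (simp only: measure_of_of_measure)
qed

lemma neg_variation_density:
  assumes r: "integrable P r" and Q: "\<And>A. A \<in> sets P \<Longrightarrow> Q A = (LINT x:A|P. r x)"
  shows "neg_variation P Q = density P (\<lambda>x. ennreal (- r x))"
  unfolding neg_variation_def
  by (rule pos_variation_density) (use r Q in \<open>auto simp: set_lebesgue_integral_def\<close>)

lemma total_variation_density:
  assumes r: "integrable P r" and Q: "\<And>A. A \<in> sets P \<Longrightarrow> Q A = (LINT x:A|P. r x)"
  shows "total_variation P Q = density P (\<lambda>x. ennreal \<bar>r x\<bar>)"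
proof -
  have [measurable]: "r \<in> borel_measurable P" using r by auto
  let ?D = "density P (\<lambda>x. ennreal \<bar>r x\<bar>)"
  have pos: "pos_variation P Q = density P (\<lambda>x. ennreal (r x))"
    by (rule pos_variation_density[OF r]) (rule Q)
  have neg: "neg_variation P Q = density P (\<lambda>x. ennreal (- r x))"
    by (rule neg_variation_density[OF r]) (rule Q)
  have eq: "emeasure (pos_variation P Q) A + emeasure (neg_variation P Q) A = emeasure ?D A"
    if A[measurable]: "A \<in> sets P" for A
    unfolding pos neg
    by (simp add: emeasure_density nn_integral_add[symmetric])
       (auto intro!: nn_integral_cong simp: abs_if ennreal_neg split: split_indicator)
  have "total_variation P Q = measure_of (space ?D) (sets ?D) (emeasure ?D)"
    unfolding total_variation_def space_density sets_density
    by (rule measure_of_eq) (use sets.space_closed eq in \<open>auto simp: sets.sigma_sets_eq\<close>)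
  then show ?thesis by (simp only: measure_of_of_measure)
qed

text \<open>
  With the Jordan decomposition computed from a density, integration with respect to a signed
  measure turns into ordinary integration against that density.
\<close>

lemma integrates_iff_integrable:
  assumes r: "integrable P r" and Q: "\<And>A. A \<in> sets P \<Longrightarrow> Q A = (LINT x:A|P. r x)"
    and f: "f \<in> borel_measurable P"
  shows "integrates P Q f \<longleftrightarrow> integrable P (\<lambda>x. r x * f x)"
proof -
  have [measurable]: "r \<in> borel_measurable P" "f \<in> borel_measurable P" using r f by auto
  have tv: "total_variation P Q = density P (\<lambda>x. ennreal \<bar>r x\<bar>)"
    by (rule total_variation_density[OF r]) (rule Q)
  show ?thesis
    unfolding integrates_def tv integrable_iff_bounded
    by (simp add: nn_integral_density ennreal_mult abs_mult)
qed

lemma signed_integral_eq: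
  assumes r: "integrable P r" and Q: "\<And>A. A \<in> sets P \<Longrightarrow> Q A = (LINT x:A|P. r x)"
    and f: "f \<in> borel_measurable P" and int: "integrable P (\<lambda>x. r x * f x)"
  shows "signed_integral P Q f = (LINT x|P. r x * f x)"
proof -
  have [measurable]: "r \<in> borel_measurable P" "f \<in> borel_measurable P" using r f by auto
  have "(\<lambda>x. ennreal (r x)) = (\<lambda>x. ennreal (max 0 (r x)))"
    and "(\<lambda>x. ennreal (- r x)) = (\<lambda>x. ennreal (max 0 (- r x)))"
    by (auto simp: max_def ennreal_neg fun_eq_iff)
  then have pos: "pos_variation P Q = density P (\<lambda>x. ennreal (max 0 (r x)))"
    and neg: "neg_variation P Q = density P (\<lambda>x. ennreal (max 0 (- r x)))"
    using pos_variation_density[OF r, of Q] neg_variation_density[OF r, of Q] Q by simp_all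
  have bound: "\<bar>max 0 (r x) * f x\<bar> \<le> \<bar>r x * f x\<bar>" "\<bar>max 0 (- r x) * f x\<bar> \<le> \<bar>r x * f x\<bar>" for x
    by (auto simp: abs_mult intro!: mult_right_mono)
  have i: "integrable P (\<lambda>x. max 0 (r x) * f x)" "integrable P (\<lambda>x. max 0 (- r x) * f x)"
    by (rule Bochner_Integration.integrable_bound[OF int]; use bound in simp)+
  have "signed_integral P Q f = (LINT x|P. max 0 (r x) * f x) - (LINT x|P. max 0 (- r x) * f x)"
    unfolding signed_integral_def pos neg by (subst (1 2) integral_density) auto
  also have "\<dots> = (LINT x|P. max 0 (r x) * f x - max 0 (- r x) * f x)"
    using i by simp
  also have "\<dots> = (LINT x|P. r x * f x)"
    by (rule Bochner_Integration.integral_cong) (auto simp: max_def)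
  finally show ?thesis .
qed

section \<open>Convex functions on the line and Young's inequality\<close>

text \<open>
  Convex extended-real functions on the line, such as a divergence function and its conjugate,
  are Borel because their sublevel sets are intervals.
\<close>

lemma borel_measurable_interval_sublevels:
  fixes F :: "real \<Rightarrow> ereal"
  assumes "\<And>c. is_interval {x. F x \<le> c}"
  shows "F \<in> borel_measurable borel"
  using real_interval_borel_measurable[OF assms]
  by (simp add: borel_measurable_iff_Iic_ereal vimage_def)

lemma conjugate_upper: "ereal (t * x) - \<phi> x \<le> conjugate \<phi> t"
  unfolding conjugate_def by (rule SUP_upper) simp

lemma borel_measurable_conjugate [measurable]: "conjugate \<phi> \<in> borel_measurable borel"
proof (rule borel_measurable_interval_sublevels)
  \<comment> \<open>A line in \<open>t\<close> of either slope sign lies below its larger endpoint value.\<close>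
  fix c
  show "is_interval {t. conjugate \<phi> t \<le> c}"
    unfolding is_interval_1
  proof (intro ballI allI impI)
    fix s u t assume s: "s \<in> {t. conjugate \<phi> t \<le> c}" and u: "u \<in> {t. conjugate \<phi> t \<le> c}"
      and t: "s \<le> t \<and> t \<le> u"
    have "ereal (t * x) - \<phi> x \<le> c" for x
    proof (cases "0 \<le> x")
      case True
      then have "ereal (t * x) - \<phi> x \<le> ereal (u * x) - \<phi> x"
        using t by (intro ereal_minus_mono) (auto intro: mult_right_mono)
      also have "\<dots> \<le> c" using conjugate_upper[of u x \<phi>] u by auto
      finally show ?thesis .
    next
      case False
      then have "ereal (t * x) - \<phi> x \<le> ereal (s * x) - \<phi> x"
        using t by (intro ereal_minus_mono) (auto intro: mult_right_mono_neg)
      also have "\<dots> \<le> c" using conjugate_upper[of s x \<phi>] s by auto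
      finally show ?thesis .
    qed
    then show "t \<in> {t. conjugate \<phi> t \<le> c}"
      unfolding conjugate_def by (auto intro: SUP_least)
  qed
qed

locale divergence =
  fixes \<phi> :: "real \<Rightarrow> ereal"
  assumes divergence_function: "divergence_function \<phi>"
begin

text \<open>
  The real-valued version of \<open>\<phi>\<close>, on which calculus can be done; it represents \<open>\<phi>\<close> on the
  effective domain and carries the junk value 0 outside.
\<close>

definition \<psi> :: "real \<Rightarrow> real" where
  "\<psi> x = real_of_ereal (\<phi> x)"

lemma phi_nonneg: "0 \<le> \<phi> x"
  using divergence_function by (simp add: divergence_function_def)

lemma psi_nonneg: "0 \<le> \<psi> x"
  unfolding \<psi>_def by (rule real_of_ereal_pos[OF phi_nonneg])

lemma phi_eq_psi: "x \<in> phi_dom \<phi> \<Longrightarrow> \<phi> x = ereal (\<psi> x)"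
  using phi_nonneg[of x] by (cases "\<phi> x") (auto simp: phi_dom_def \<psi>_def)

lemma phi_not_in_dom: "x \<notin> phi_dom \<phi> \<Longrightarrow> \<phi> x = \<infinity>"
  by (simp add: phi_dom_def)

lemma phi_le_max:
  assumes "x \<le> y" "y \<le> z"
  shows "\<phi> y \<le> max (\<phi> x) (\<phi> z)"
proof (cases "x = z")
  case True
  then show ?thesis using assms by auto
next
  case False
  define t where "t = (y - x) / (z - x)"
  have t: "0 \<le> t" "t \<le> 1" using assms False by (auto simp: t_def field_simps)
  have "t * (z - x) = y - x" using False by (simp add: t_def)
  then have y: "y = (1 - t) * x + t * z" by (simp add: algebra_simps)
  let ?m = "max (\<phi> x) (\<phi> z)"
  have "\<phi> y \<le> ereal (1 - t) * \<phi> x + ereal t * \<phi> z"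
    using divergence_function t unfolding y divergence_function_def phi_convex_def by blast
  also have "\<dots> \<le> ereal (1 - t) * ?m + ereal t * ?m"
    using t by (intro add_mono ereal_mult_left_mono) auto
  also have "\<dots> = (ereal (1 - t) + ereal t) * ?m"
    using t by (intro ereal_left_distrib[symmetric]) auto
  also have "\<dots> = ?m" by simp
  finally show ?thesis .
qed

lemma borel_measurable_phi [measurable]: "\<phi> \<in> borel_measurable borel"
proof (rule borel_measurable_interval_sublevels)
  show "is_interval {x. \<phi> x \<le> c}" for c
    unfolding is_interval_1 using phi_le_max by (fastforce intro: order_trans)
qed

lemma borel_measurable_psi [measurable]: "\<psi> \<in> borel_measurable borel"
  unfolding \<psi>_def[abs_def] by measurable

lemma phi_dom_between: "x \<in> phi_dom \<phi> \<Longrightarrow> z \<in> phi_dom \<phi> \<Longrightarrow> x \<le> y \<Longrightarrow> y \<le> z \<Longrightarrow> y \<in> phi_dom \<phi>"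
  using phi_le_max[of x y z] by (auto simp: phi_dom_def max_def split: if_splits)

lemma psi_le_sum:
  assumes x: "x \<in> phi_dom \<phi>" and z: "z \<in> phi_dom \<phi>" and y: "x \<le> y" "y \<le> z"
  shows "\<psi> y \<le> \<psi> x + \<psi> z"
proof -
  have "\<psi> y \<le> max (\<psi> x) (\<psi> z)"
    using phi_le_max[OF y] phi_dom_between[OF x z y] x z
    by (auto simp: phi_eq_psi max_def split: if_splits)
  then show ?thesis using psi_nonneg[of x] psi_nonneg[of z] by (auto simp: max_def split: if_splits)
qed

lemma convex_on_psi: "convex_on (phi_dom \<phi>) \<psi>"
proof (rule convex_onI)
  show "convex (phi_dom \<phi>)"
    using divergence_function is_interval_convex by (auto simp: divergence_function_def)
  fix t x y :: real
  assume t: "0 < t" "t < 1" and xy: "x \<in> phi_dom \<phi>" "y \<in> phi_dom \<phi>"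
  have "(1 - t) *\<^sub>R x + t *\<^sub>R y \<in> phi_dom \<phi>"
    using \<open>convex (phi_dom \<phi>)\<close> t xy by (intro convexD) auto
  moreover have "\<phi> ((1 - t) * x + t * y) \<le> ereal (1 - t) * \<phi> x + ereal t * \<phi> y"
    using divergence_function t unfolding divergence_function_def phi_convex_def by auto
  ultimately show "\<psi> ((1 - t) *\<^sub>R x + t *\<^sub>R y) \<le> (1 - t) * \<psi> x + t * \<psi> y"
    using xy by (simp add: phi_eq_psi)
qed

lemma psi_above_tangent:
  assumes x: "x \<in> interior (phi_dom \<phi>)" and d: "(\<psi> has_field_derivative d) (at x)"
    and y: "y \<in> phi_dom \<phi>"
  shows "\<psi> x + d * (y - x) \<le> \<psi> y"
proof -
  have "connected (phi_dom \<phi>)"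
    using divergence_function is_interval_connected by (auto simp: divergence_function_def)
  from convex_on_imp_above_tangent[OF convex_on_psi this x y has_field_derivative_at_within[OF d]]
  show ?thesis by linarith
qed

text \<open>
  Equality in Young's inequality \<open>t x - \<phi>(x) \<le> \<phi>\<^sup>*(t)\<close> says that \<open>t\<close> is a subgradient at \<open>x\<close>.
  At an interior point of differentiability the derivative is a subgradient by convexity.
\<close>

lemma conjugate_at_derivative:
  assumes x: "x \<in> interior (phi_dom \<phi>)" and d: "(\<psi> has_field_derivative d) (at x)"
  shows "conjugate \<phi> d = ereal (d * x - \<psi> x)"
proof (rule antisym)
  show "conjugate \<phi> d \<le> ereal (d * x - \<psi> x)"
    unfolding conjugate_def
  proof (rule SUP_least)
    fix y
    show "ereal (d * y) - \<phi> y \<le> ereal (d * x - \<psi> x)"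
    proof (cases "y \<in> phi_dom \<phi>")
      case True
      then show ?thesis
        using psi_above_tangent[OF x d True] by (simp add: phi_eq_psi algebra_simps)
    qed (simp add: phi_not_in_dom)
  qed
  show "ereal (d * x - \<psi> x) \<le> conjugate \<phi> d"
    using conjugate_upper[of d x \<phi>] phi_eq_psi[of x] x interior_subset[of "phi_dom \<phi>"] by auto
qed

text \<open>
  Conversely, equality makes \<open>x\<close> a maximiser of \<open>y \<mapsto> t y - \<phi>(y)\<close>, and the derivative of this
  function vanishes at an interior maximum.
\<close>

lemma conjugate_equality_imp_derivative:
  assumes x: "x \<in> interior (phi_dom \<phi>)" and d: "(\<psi> has_field_derivative d) (at x)"
    and eq: "conjugate \<phi> t = ereal (t * x - \<psi> x)"
  shows "t = d"
proof -
  obtain e where e: "0 < e" "ball x e \<subseteq> phi_dom \<phi>"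
    using x by (auto simp: mem_interior)
  have "((\<lambda>y. t * y - \<psi> y) has_field_derivative (t - d)) (at x)"
    by (auto intro!: derivative_eq_intros d)
  moreover have "\<forall>y. \<bar>x - y\<bar> < e \<longrightarrow> t * y - \<psi> y \<le> t * x - \<psi> x"
  proof (intro allI impI)
    fix y assume "\<bar>x - y\<bar> < e"
    then have "y \<in> phi_dom \<phi>" using e(2) by (auto simp: dist_real_def)
    then show "t * y - \<psi> y \<le> t * x - \<psi> x"
      using conjugate_upper[of t y \<phi>] eq by (simp add: phi_eq_psi)
  qed
  ultimately show ?thesis using DERIV_local_max[of _ "t - d" x e] e(1) by simp
qed

lemma surrounded_imp_interior:
  assumes "a \<in> phi_dom \<phi>" "b \<in> phi_dom \<phi>" "a < x" "x < b"
  shows "x \<in> interior (phi_dom \<phi>)" "left_end \<phi> < ereal x" "ereal x < right_end \<phi>"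
proof -
  have "{a<..<b} \<subseteq> phi_dom \<phi>" using phi_dom_between[OF assms(1,2)] by auto
  then show "x \<in> interior (phi_dom \<phi>)"
    using assms(3,4) by (intro interiorI[of "{a<..<b}"]) auto
  have "left_end \<phi> \<le> ereal a" unfolding left_end_def by (rule INF_lower) fact
  then show "left_end \<phi> < ereal x" using assms(3) by (simp add: order_le_less_trans)
  have "ereal b \<le> right_end \<phi>" unfolding right_end_def by (rule SUP_upper) fact
  then show "ereal x < right_end \<phi>" using assms(4) less_le_trans[of "ereal x" "ereal b"] by simp
qed

text \<open>
  By convexity a difference quotient with step at most 1 lies between the two quotients with
  steps 1 and -1, hence is bounded independently of the step.  This is what permits
  differentiation under the integral sign.
\<close>

lemma difference_quotient_bound:
  assumes x: "x \<in> interior (phi_dom \<phi>)" and d: "(\<psi> has_field_derivative d) (at x)"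
    and k: "x + k \<in> phi_dom \<phi>" "x - k \<in> phi_dom \<phi>" and s: "0 < s" "s \<le> 1"
  shows "\<bar>(\<psi> (x + s * k) - \<psi> x) / s\<bar> \<le> \<psi> (x + k) + \<psi> (x - k)"
proof -
  have x': "x \<in> phi_dom \<phi>" using x interior_subset by auto
  have "x + s * k = (1 - s) *\<^sub>R x + s *\<^sub>R (x + k)" by (simp add: algebra_simps)
  moreover have conv: "convex (phi_dom \<phi>)" using convex_on_psi by (rule convex_on_imp_convex)
  ultimately have dom: "x + s * k \<in> phi_dom \<phi>"
    using convexD[OF conv x' k(1), of "1 - s" s] s by simp
  have "\<psi> (x + s * k) \<le> (1 - s) * \<psi> x + s * \<psi> (x + k)"
    using convex_onD[OF convex_on_psi, of s x "x + k"] s x' k(1)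
    by (simp add: algebra_simps)
  then have "(\<psi> (x + s * k) - \<psi> x) / s \<le> \<psi> (x + k) - \<psi> x"
    using s by (simp add: field_simps)
  moreover have "d * k \<le> (\<psi> (x + s * k) - \<psi> x) / s"
    using psi_above_tangent[OF x d dom] s by (simp add: field_simps)
  moreover have "\<psi> x - \<psi> (x - k) \<le> d * k"
    using psi_above_tangent[OF x d k(2)] by simp
  ultimately show ?thesis
    using psi_nonneg[of x] psi_nonneg[of "x + k"] psi_nonneg[of "x - k"] by linarith
qed

lemma difference_quotient_LIMSEQ:
  assumes d: "(\<psi> has_field_derivative d) (at x)"
  shows "(\<lambda>n. (\<psi> (x + 1 / real (Suc n) * k) - \<psi> x) / (1 / real (Suc n))) \<longlonglongrightarrow> d * k"
proof -
  have "((\<lambda>s. \<psi> (x + s * k)) has_field_derivative d * k) (at 0)"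
    by (rule DERIV_chain2[where f = \<psi>]) (use d in \<open>auto intro!: derivative_eq_intros\<close>)
  then have "((\<lambda>s. (\<psi> (x + s * k) - \<psi> x) / s) \<longlongrightarrow> d * k) (at 0)"
    by (simp add: has_field_derivative_iff)
  moreover have "filterlim (\<lambda>n. 1 / real (Suc n)) (at 0) sequentially"
    using LIMSEQ_Suc[OF lim_1_over_n[where ?'a = real]] by (simp add: filterlim_at)
  ultimately show ?thesis by (rule filterlim_compose)
qed

end

section \<open>Extended-real integrals and finite-dimensional annihilators\<close>

lemma ereal_integral_eq_integral:
  assumes h: "integrable M h" and F: "AE x in M. F x = ereal (h x)"
  shows "ereal_integral M F = ereal (LINT x|M. h x)"
proof -
  have "(\<integral>\<^sup>+x. e2ennreal (F x) \<partial>M) = (\<integral>\<^sup>+x. ennreal (h x) \<partial>M)"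
    and "(\<integral>\<^sup>+x. e2ennreal (- F x) \<partial>M) = (\<integral>\<^sup>+x. ennreal (- h x) \<partial>M)"
    by (rule nn_integral_cong_AE; use F in \<open>auto elim!: eventually_mono simp: e2ennreal_ereal\<close>)+
  moreover obtain a b where "0 \<le> a" "0 \<le> b" "(\<integral>\<^sup>+x. ennreal (h x) \<partial>M) = ennreal a"
     "(\<integral>\<^sup>+x. ennreal (- h x) \<partial>M) = ennreal b" "(LINT x|M. h x) = a - b"
    using integrableE[OF h] by metis
  ultimately show ?thesis by (simp add: ereal_integral_def)
qed

lemma ereal_integral_ge_integral:
  assumes h: "integrable M h" and F: "AE x in M. ereal (h x) \<le> F x"
  shows "ereal (LINT x|M. h x) \<le> ereal_integral M F"
proof -
  have "AE x in M. e2ennreal (ereal (h x)) \<le> e2ennreal (F x)"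
    using F by eventually_elim (rule e2ennreal_mono)
  moreover have "AE x in M. e2ennreal (- F x) \<le> e2ennreal (- ereal (h x))"
    using F by eventually_elim (simp only: e2ennreal_mono ereal_minus_le_minus)
  ultimately have "(\<integral>\<^sup>+x. e2ennreal (ereal (h x)) \<partial>M) \<le> (\<integral>\<^sup>+x. e2ennreal (F x) \<partial>M)"
    and "(\<integral>\<^sup>+x. e2ennreal (- F x) \<partial>M) \<le> (\<integral>\<^sup>+x. e2ennreal (- ereal (h x)) \<partial>M)"
    by (simp_all only: nn_integral_mono_AE)
  then have "ereal_integral M (\<lambda>x. ereal (h x)) \<le> ereal_integral M F"
    unfolding ereal_integral_def by (intro ereal_minus_mono) (auto simp: less_eq_ennreal.rep_eq)
  then show ?thesis using ereal_integral_eq_integral[OF h, of "\<lambda>x. ereal (h x)"] by simp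
qed

text \<open>
  The minorant controls the negative part, so a value below infinity forces the positive part to
  have a finite integral too.
\<close>

lemma ereal_integral_finite:
  assumes F[measurable]: "F \<in> borel_measurable M" and h: "integrable M h"
    and ge: "AE x in M. ereal (h x) \<le> F x" and fin: "ereal_integral M F < \<infinity>"
  shows "AE x in M. F x = ereal (real_of_ereal (F x))"
    and "integrable M (\<lambda>x. real_of_ereal (F x))"
proof -
  obtain b where b: "(\<integral>\<^sup>+x. ennreal (- h x) \<partial>M) = ennreal b"
    using integrableE[OF h] by metis
  have "(\<integral>\<^sup>+x. e2ennreal (- F x) \<partial>M) \<le> (\<integral>\<^sup>+x. ennreal (- h x) \<partial>M)"
    by (rule nn_integral_mono_AE)
       (use ge in \<open>auto elim!: eventually_mono intro!: e2ennreal_mono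
          simp: e2ennreal_ereal[symmetric] simp del: uminus_ereal.simps simp flip: uminus_ereal.simps\<close>)
  then have neg: "(\<integral>\<^sup>+x. e2ennreal (- F x) \<partial>M) < \<infinity>"
    using b by (simp add: le_less_trans)
  have pos: "(\<integral>\<^sup>+x. e2ennreal (F x) \<partial>M) < \<infinity>"
  proof (rule ccontr)
    assume "\<not> ?thesis"
    then have "(\<integral>\<^sup>+x. e2ennreal (F x) \<partial>M) = \<infinity>" by (simp add: top.not_eq_extremum[symmetric])
    then show False using fin by (simp add: ereal_integral_def)
  qed
  have "AE x in M. e2ennreal (F x) \<noteq> \<infinity>"
    by (rule nn_integral_PInf_AE) (use pos in auto)
  with ge show eq: "AE x in M. F x = ereal (real_of_ereal (F x))"
  proof eventually_elim
    case (elim x)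
    then show ?case by (cases "F x") auto
  qed
  show "integrable M (\<lambda>x. real_of_ereal (F x))"
    unfolding real_integrable_def
  proof (intro conjI)
    have "(\<integral>\<^sup>+x. ennreal (real_of_ereal (F x)) \<partial>M) = (\<integral>\<^sup>+x. e2ennreal (F x) \<partial>M)"
      by (rule nn_integral_cong_AE)
         (use eq in \<open>eventually_elim; metis e2ennreal_ereal\<close>)
    then show "(\<integral>\<^sup>+x. ennreal (real_of_ereal (F x)) \<partial>M) \<noteq> \<infinity>" using pos by simp
    have "(\<integral>\<^sup>+x. ennreal (- real_of_ereal (F x)) \<partial>M) = (\<integral>\<^sup>+x. e2ennreal (- F x) \<partial>M)"
      by (rule nn_integral_cong_AE)
         (use eq in \<open>eventually_elim; metis e2ennreal_ereal uminus_ereal.simps(1)\<close>)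
    then show "(\<integral>\<^sup>+x. ennreal (- real_of_ereal (F x)) \<partial>M) \<noteq> \<infinity>" using neg by simp
  qed simp
qed

text \<open>
  The equality case of monotonicity: a nonnegative difference with integral zero vanishes almost
  everywhere.
\<close>

lemma ereal_integral_eq_imp_AE_eq:
  assumes F: "F \<in> borel_measurable M" and h: "integrable M h"
    and ge: "AE x in M. ereal (h x) \<le> F x" and eq: "ereal_integral M F = ereal (LINT x|M. h x)"
  shows "AE x in M. F x = ereal (h x)"
proof -
  have fin: "ereal_integral M F < \<infinity>" using eq by simp
  note F_real = ereal_integral_finite[OF F h ge fin]
  let ?f = "\<lambda>x. real_of_ereal (F x)"
  have "(LINT x|M. ?f x - h x) = 0"
    using ereal_integral_eq_integral[OF F_real(2,1)] eq F_real(2) h by simp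
  moreover have "AE x in M. 0 \<le> ?f x - h x"
    using ge F_real(1) by eventually_elim (metis diff_ge_0_iff_ge ereal_less_eq(3))
  ultimately have "AE x in M. ?f x - h x = 0"
    using F_real(2) h by (subst (asm) integral_nonneg_eq_0_iff_AE) auto
  with F_real(1) show ?thesis by eventually_elim (metis eq_iff_diff_eq_0)
qed

text \<open>
  The test function is the sign of \<open>f\<close>.
\<close>

lemma AE_zero_of_orthogonal_bounded:
  fixes f :: "'a \<Rightarrow> real"
  assumes f: "integrable M f"
    and orth: "\<And>h. h \<in> borel_measurable M \<Longrightarrow> (\<And>x. \<bar>h x\<bar> \<le> 1) \<Longrightarrow> (LINT x|M. f x * h x) = 0"
  shows "AE x in M. f x = 0"
proof -
  have [measurable]: "f \<in> borel_measurable M" using f by auto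
  have "(LINT x|M. \<bar>f x\<bar>) = (LINT x|M. f x * sgn (f x))"
    by (simp add: abs_sgn)
  also have "\<dots> = 0" by (rule orth) (auto simp: sgn_if)
  finally show ?thesis
    using integral_nonneg_eq_0_iff_AE[of M "\<lambda>x. \<bar>f x\<bar>"] f by simp
qed

lemma integrable_mult_bounded:
  fixes f h :: "'a \<Rightarrow> real"
  assumes f: "integrable M f" and h: "h \<in> borel_measurable M" "\<And>x. \<bar>h x\<bar> \<le> K"
  shows "integrable M (\<lambda>x. f x * h x)"
proof (rule Bochner_Integration.integrable_bound)
  show "integrable M (\<lambda>x. K * f x)" using f by simp
  show "AE x in M. norm (f x * h x) \<le> norm (K * f x)"
  proof (rule AE_I2)
    fix x
    have "0 \<le> K" using h(2)[of x] by linarith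
    then show "norm (f x * h x) \<le> norm (K * f x)"
      using mult_left_mono[OF h(2)[of x] abs_ge_zero[of "f x"]]
      by (simp add: abs_mult mult.commute)
  qed
qed (use f h in measurable)

text \<open>
  Lagrange multipliers.  If every bounded \<open>h\<close> that annihilates the finitely many integrable
  functions \<open>u\<^sub>j\<close> also annihilates \<open>f\<close>, then \<open>f\<close> is a linear combination of the \<open>u\<^sub>j\<close>.
  The vectors \<open>(\<integral>u\<^sub>j h)\<^sub>j\<close> paired with \<open>\<integral>f h\<close> form a subspace of a Euclidean space, and the
  hypothesis says that it misses \<open>e = (0, 1)\<close>.  So the component \<open>z\<close> of \<open>e\<close> orthogonal to this
  subspace is nonzero; its last coordinate is \<open>\<bar>z\<bar>\<^sup>2 > 0\<close>, and dividing by it, the orthogonality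
  relation expresses \<open>\<integral>f h\<close> through the \<open>\<integral>u\<^sub>j h\<close> for all bounded \<open>h\<close> at once.
\<close>

lemma integrable_in_span_of_annihilator:
  fixes u :: "'j::finite \<Rightarrow> 'a \<Rightarrow> real" and f :: "'a \<Rightarrow> real"
  assumes f: "integrable M f" and u: "\<And>j. integrable M (u j)"
    and ann: "\<And>h. h \<in> borel_measurable M \<Longrightarrow> (\<And>x. \<bar>h x\<bar> \<le> 1) \<Longrightarrow>
        (\<And>j. (LINT x|M. u j x * h x) = 0) \<Longrightarrow> (LINT x|M. f x * h x) = 0"
  shows "\<exists>a :: real ^ 'j. AE x in M. f x = (\<Sum>j\<in>UNIV. a $ j * u j x)"
proof -
  define B where "B = {h \<in> borel_measurable M. \<exists>K. \<forall>x. \<bar>h x\<bar> \<le> (K::real)}"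
  define T where "T h = ((\<chi> j. LINT x|M. u j x * h x) :: real ^ 'j, LINT x|M. f x * h x)" for h
  have int: "integrable M (\<lambda>x. f x * h x)" "integrable M (\<lambda>x. u j x * h x)" if "h \<in> B" for h j
    using that by (auto simp: B_def intro!: integrable_mult_bounded f u)
  have B_add: "(\<lambda>x. h x + k x) \<in> B" if hk: "h \<in> B" "k \<in> B" for h k
  proof -
    obtain K L where KL: "\<And>x. \<bar>h x\<bar> \<le> K" "\<And>x. \<bar>k x\<bar> \<le> L" using hk by (auto simp: B_def)
    have "\<bar>h x + k x\<bar> \<le> K + L" for x using KL(1)[of x] KL(2)[of x] by linarith
    then show ?thesis using hk by (auto simp: B_def)
  qed
  have B_scale: "(\<lambda>x. c * h x) \<in> B" if h: "h \<in> B" for c h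
  proof -
    obtain K where "\<And>x. \<bar>h x\<bar> \<le> K" using h by (auto simp: B_def)
    then have "\<bar>c * h x\<bar> \<le> \<bar>c\<bar> * K" for x by (simp add: abs_mult mult_left_mono)
    then show ?thesis using h by (auto simp: B_def)
  qed
  have T_add: "T (\<lambda>x. h x + k x) = T h + T k" if "h \<in> B" "k \<in> B" for h k
    using int that by (simp add: T_def vec_eq_iff distrib_left)
  have T_scale: "T (\<lambda>x. c * h x) = c *\<^sub>R T h" for h c
    by (simp add: T_def vec_eq_iff mult.left_commute)
  have sub: "subspace (T ` B)"
    unfolding subspace_def
  proof (intro conjI ballI allI)
    have "(\<lambda>x. 0) \<in> B" by (auto simp: B_def)
    moreover have "T (\<lambda>x. 0) = 0" by (simp add: T_def vec_eq_iff zero_prod_def)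
    ultimately show "0 \<in> T ` B" by (metis imageI)
  next
    fix x y assume "x \<in> T ` B" "y \<in> T ` B"
    then show "x + y \<in> T ` B" using T_add B_add by (auto simp: image_iff) metis
  next
    fix c x assume "x \<in> T ` B"
    then show "c *\<^sub>R x \<in> T ` B" using T_scale B_scale by (auto simp: image_iff) metis
  qed
  define e where "e = (0 :: real ^ 'j, 1 :: real)"
  obtain y z where y: "y \<in> span (T ` B)" and orth: "\<And>w. w \<in> span (T ` B) \<Longrightarrow> orthogonal z w"
    and e: "e = y + z"
    using orthogonal_subspace_decomp_exists[of "T ` B" e] by metis
  have span: "span (T ` B) = T ` B" using sub by (rule span_eq_iff[THEN iffD2])
  have "z \<noteq> 0"
  proof
    assume "z = 0"
    then obtain h where h: "h \<in> B" "T h = e" using e y span by auto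
    then obtain K where K: "\<And>x. \<bar>h x\<bar> \<le> K" by (auto simp: B_def)
    \<comment> \<open>Rescaling brings the test function below 1; the added 1 excludes division by 0.\<close>
    let ?h = "\<lambda>x. 1 / (\<bar>K\<bar> + 1) * h x"
    have e_h: "T ?h = (1 / (\<bar>K\<bar> + 1)) *\<^sub>R e" by (simp only: T_scale h(2))
    have "(LINT x|M. f x * ?h x) = 0"
    proof (rule ann)
      show "?h \<in> borel_measurable M" using h(1) by (auto simp: B_def)
      show "\<bar>?h x\<bar> \<le> 1" for x using K[of x] by (simp add: abs_mult field_simps)
      show "(LINT x|M. u j x * ?h x) = 0" for j
        using arg_cong[OF e_h, of "\<lambda>v. fst v $ j"] by (simp add: T_def e_def)
    qed
    moreover have "(LINT x|M. f x * ?h x) = 1 / (\<bar>K\<bar> + 1)"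
      using arg_cong[OF e_h, of snd] by (simp add: T_def e_def)
    ultimately have "1 / (\<bar>K\<bar> + 1) = 0" by (rule trans[OF sym, rotated])
    moreover have "\<bar>K\<bar> + 1 > 0" by linarith
    ultimately show False by (metis divide_pos_pos less_irrefl zero_less_one)
  qed
  have "z \<bullet> y = 0" using orth[OF y] by (simp add: orthogonal_def)
  then have "z \<bullet> e = z \<bullet> z" by (simp add: e inner_add_right)
  then have z2: "snd z > 0"
    using \<open>z \<noteq> 0\<close> by (cases z) (auto simp: e_def inner_gt_zero_iff[symmetric] simp del: inner_gt_zero_iff)
  define a :: "real ^ 'j" where "a = - (1 / snd z) *\<^sub>R fst z"
  let ?r = "\<lambda>x. f x - (\<Sum>j\<in>UNIV. a $ j * u j x)"
  have "AE x in M. ?r x = 0"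
  proof (rule AE_zero_of_orthogonal_bounded)
    show "integrable M ?r" using f u by simp
    fix h :: "'a \<Rightarrow> real" assume h: "h \<in> borel_measurable M" "\<And>x. \<bar>h x\<bar> \<le> 1"
    then have hB: "h \<in> B" by (auto simp: B_def)
    have "z \<bullet> T h = 0" using orth hB span by (auto simp: orthogonal_def)
    then have *: "(\<Sum>j\<in>UNIV. fst z $ j * (LINT x|M. u j x * h x)) + snd z * (LINT x|M. f x * h x) = 0"
      by (cases z) (simp add: T_def inner_vec_def)
    have "(LINT x|M. ?r x * h x) = (LINT x|M. f x * h x - (\<Sum>j\<in>UNIV. a $ j * (u j x * h x)))"
      by (simp add: left_diff_distrib sum_distrib_right mult.assoc)
    also have "\<dots> = (LINT x|M. f x * h x) - (\<Sum>j\<in>UNIV. a $ j * (LINT x|M. u j x * h x))"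
      using int[OF hB] by simp
    also have "(\<Sum>j\<in>UNIV. a $ j * (LINT x|M. u j x * h x))
        = - (1 / snd z) * (\<Sum>j\<in>UNIV. fst z $ j * (LINT x|M. u j x * h x))"
      by (simp add: a_def sum_distrib_left mult.assoc)
    also have "\<dots> = (LINT x|M. f x * h x)"
      using * z2 by (simp add: field_simps)
    finally show "(LINT x|M. ?r x * h x) = 0" by simp
  qed
  then show ?thesis by (intro exI[of _ a]) (auto elim!: eventually_mono)
qed

section \<open>First-order conditions at a projection with full support\<close>

lemma option_sum:
  fixes f :: "'l::finite option \<Rightarrow> 'b::comm_monoid_add"
  shows "(\<Sum>j\<in>UNIV. f j) = f None + (\<Sum>i\<in>UNIV. f (Some i))"
  by (simp add: UNIV_option_conv sum.insert sum.reindex)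

lemma inner_gvec: "u \<bullet> gvec g x = u $ None + (\<Sum>i\<in>UNIV. u $ Some i * g i x)"
  by (simp add: inner_vec_def gvec_def option_sum)

lemma inner_gvec_sum: "u \<bullet> gvec g x = (\<Sum>j\<in>UNIV. u $ j * gvec g x $ j)"
  by (simp add: inner_vec_def)

lemma option_all: "(\<forall>j. R j) \<longleftrightarrow> R None \<and> (\<forall>i. R (Some i))"
  by (metis option.exhaust)

lemma borel_measurable_gvec:
  assumes "\<And>i. g i \<in> borel_measurable M"
  shows "(\<lambda>x. gvec g x $ j) \<in> borel_measurable M"
  using assms by (cases j) (simp_all add: gvec_def)

text \<open>
  Since \<open>g\<^sub>0 = 1\<close>, the normalisation \<open>Q(X) = 1\<close> and the moment conditions are one family of
  conditions on the density, indexed by \<open>{0, \<dots>, l}\<close>.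
\<close>

lemma M_set_iff_density:
  fixes g :: "'l::finite \<Rightarrow> 'a \<Rightarrow> real"
  assumes g: "\<And>i. g i \<in> borel_measurable P"
    and Q: "Q \<in> ac_signed_measures P"
    and r: "integrable P r" and dens: "\<And>A. A \<in> sets P \<Longrightarrow> Q A = (LINT x:A|P. r x)"
  shows "Q \<in> M_set P g \<longleftrightarrow>
    (\<forall>j. integrable P (\<lambda>x. r x * gvec g x $ j) \<and>
         (LINT x|P. r x * gvec g x $ j) = (if j = None then 1 else 0))"
proof -
  have "Q (space P) = (LINT x|P. r x)"
    using dens[OF sets.top] by (simp add: set_lebesgue_integral_def cong: Bochner_Integration.integral_cong)
  moreover have "integrates P Q (g i) \<longleftrightarrow> integrable P (\<lambda>x. r x * g i x)" for i
    by (rule integrates_iff_integrable[OF r _ g]) (rule dens)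
  moreover have "signed_integral P Q (g i) = (LINT x|P. r x * g i x)"
    if "integrable P (\<lambda>x. r x * g i x)" for i
    by (rule signed_integral_eq[OF r _ g that]) (rule dens)
  ultimately show ?thesis
    using Q r by (auto simp: M_set_def gvec_def option_all)
qed

text \<open>
  The situation of the theorem, with the constant \<open>\<delta>\<close> of the growth condition fixed.
\<close>

locale supported_projection = divergence \<phi> + prob_space P
  for \<phi> :: "real \<Rightarrow> ereal" and P :: "'a measure" +
  fixes g :: "'l::finite \<Rightarrow> 'a \<Rightarrow> real" and Qs :: "'a set \<Rightarrow> real" and \<delta> :: real
  assumes g_meas: "g i \<in> borel_measurable P"
    and delta: "0 < \<delta>" "\<delta> < 1"
    and growth: "c \<in> {1 - \<delta>..1 + \<delta>} \<Longrightarrow> \<exists>c1 c2 c3 :: real. \<forall>x.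
                      \<phi> (c * x) \<le> ereal c1 * \<phi> x + ereal (c2 * \<bar>x\<bar> + c3)"
    and diff: "phi_differentiable \<phi>"
    and proj: "is_phi_projection \<phi> P (M_set P g) Qs"
    and supp: "same_support P Qs"
begin

definition q :: "'a \<Rightarrow> real" where "q = signed_RN_deriv P Qs"
definition slope :: "'a \<Rightarrow> real" where "slope x = deriv \<psi> (q x)"

lemma fin_P: "finite_measure P" by unfold_locales

lemma gvec_meas [measurable]: "(\<lambda>x. gvec g x $ j) \<in> borel_measurable P"
  by (rule borel_measurable_gvec[OF g_meas])

lemma Qs_ac: "Qs \<in> ac_signed_measures P" and q_nonzero: "AE x in P. q x \<noteq> 0"
  using supp by (auto simp: same_support_def q_def)

lemma q_int: "integrable P q"
  unfolding q_def by (rule signed_RN_deriv_props(1)[OF fin_P Qs_ac])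

lemma q_meas [measurable]: "q \<in> borel_measurable P"
  using q_int by auto

lemma q_moments:
  "integrable P (\<lambda>x. q x * gvec g x $ j)"
  "(LINT x|P. q x * gvec g x $ j) = (if j = None then 1 else 0)"
proof -
  have "Qs \<in> M_set P g" using proj by (simp add: is_phi_projection_def)
  then show "integrable P (\<lambda>x. q x * gvec g x $ j)"
    and "(LINT x|P. q x * gvec g x $ j) = (if j = None then 1 else 0)"
    using M_set_iff_density[of g, OF g_meas Qs_ac q_int] signed_RN_deriv_props(2)[OF fin_P Qs_ac]
    by (simp_all add: q_def)
qed

lemma divergence_Qs_eq_INF:
  "(INF Q \<in> M_set P g. phi_divergence \<phi> P Q) = phi_divergence \<phi> P Qs"
  using proj by (intro antisym INF_lower INF_greatest) (auto simp: is_phi_projection_def)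

lemma divergence_Qs: "phi_divergence \<phi> P Qs = ereal_integral P (\<lambda>x. \<phi> (q x))"
  using Qs_ac by (simp add: phi_divergence_def q_def)

lemma q_dom: "AE x in P. q x \<in> phi_dom \<phi>" and psi_q_int: "integrable P (\<lambda>x. \<psi> (q x))"
proof -
  have fin: "ereal_integral P (\<lambda>x. \<phi> (q x)) < \<infinity>"
    using proj divergence_Qs_eq_INF divergence_Qs by (simp add: is_phi_projection_def)
  have "AE x in P. ereal 0 \<le> \<phi> (q x)" using phi_nonneg by (simp add: zero_ereal_def[symmetric])
  note fin' = ereal_integral_finite[OF _ integrable_zero this fin]
  show "integrable P (\<lambda>x. \<psi> (q x))" using fin'(2) by (simp add: \<psi>_def)
  have "AE x in P. \<phi> (q x) = ereal (real_of_ereal (\<phi> (q x)))" by (rule fin'(1)) simp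
  then show "AE x in P. q x \<in> phi_dom \<phi>"
  proof eventually_elim
    case (elim x)
    have "\<phi> (q x) \<noteq> \<infinity>" by (subst elim) simp
    then show ?case using phi_not_in_dom by blast
  qed
qed

lemma divergence_Qs_eq: "phi_divergence \<phi> P Qs = ereal (LINT x|P. \<psi> (q x))"
  unfolding divergence_Qs
  by (rule ereal_integral_eq_integral[OF psi_q_int])
     (use q_dom in \<open>auto elim!: eventually_mono simp: phi_eq_psi\<close>)

text \<open>
  The growth condition is used through dilations: they preserve the effective domain and, below,
  the integrability of \<open>\<phi>(q)\<close>.
\<close>

lemma dilate_dom:
  assumes "c \<in> {1 - \<delta>..1 + \<delta>}" "x \<in> phi_dom \<phi>"
  shows "c * x \<in> phi_dom \<phi>"
proof -
  obtain c1 c2 c3 :: real where "\<phi> (c * x) \<le> ereal c1 * \<phi> x + ereal (c2 * \<bar>x\<bar> + c3)"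
    using growth[OF assms(1)] by blast
  also have "\<dots> < \<infinity>" using phi_eq_psi[OF assms(2)] by simp
  finally show ?thesis by (simp add: phi_dom_def)
qed

lemma dilate_int:
  assumes c: "c \<in> {1 - \<delta>..1 + \<delta>}"
  shows "integrable P (\<lambda>x. \<psi> (c * q x))"
proof -
  obtain c1 c2 c3 :: real where le: "\<And>x. \<phi> (c * x) \<le> ereal c1 * \<phi> x + ereal (c2 * \<bar>x\<bar> + c3)"
    using growth[OF c] by blast
  show ?thesis
  proof (rule Bochner_Integration.integrable_bound)
    show "integrable P (\<lambda>x. c1 * \<psi> (q x) + (c2 * \<bar>q x\<bar> + c3))"
      using psi_q_int q_int by simp
    show "AE x in P. norm (\<psi> (c * q x)) \<le> norm (c1 * \<psi> (q x) + (c2 * \<bar>q x\<bar> + c3))"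
      using q_dom
    proof eventually_elim
      case (elim x)
      have "\<psi> (c * q x) \<le> c1 * \<psi> (q x) + (c2 * \<bar>q x\<bar> + c3)"
        using le[of "q x"] elim dilate_dom[OF c elim] by (simp add: phi_eq_psi)
      then show ?case using psi_nonneg[of "c * q x"] by simp
    qed
  qed simp
qed

text \<open>
  A nonzero point of the domain lies strictly between its two dilates \<open>(1 - \<delta>) x\<close> and
  \<open>(1 + \<delta>) x\<close>, which also belong to the domain.  So 0 is the only possible endpoint in the
  domain, and a density without zeros takes values in the interior almost everywhere.
\<close>

lemma nonzero_dom_imp_interior:
  assumes "x \<in> phi_dom \<phi>" "x \<noteq> 0"
  shows "x \<in> interior (phi_dom \<phi>)" "left_end \<phi> < ereal x" "ereal x < right_end \<phi>"
proof -
  have m: "(1 - \<delta>) * x \<in> phi_dom \<phi>" "(1 + \<delta>) * x \<in> phi_dom \<phi>"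
    using delta assms(1) by (auto intro!: dilate_dom)
  have "\<exists>a b. a \<in> phi_dom \<phi> \<and> b \<in> phi_dom \<phi> \<and> a < x \<and> x < b"
  proof (cases "0 < x")
    case True
    then have "(1 - \<delta>) * x < x" "x < (1 + \<delta>) * x" using delta by (auto simp: algebra_simps)
    then show ?thesis using m by blast
  next
    case False
    then have "\<delta> * x < 0" using assms(2) delta by (simp add: mult_less_0_iff)
    then have "(1 + \<delta>) * x < x" "x < (1 - \<delta>) * x" by (auto simp: algebra_simps)
    then show ?thesis using m by blast
  qed
  then show "x \<in> interior (phi_dom \<phi>)" "left_end \<phi> < ereal x" "ereal x < right_end \<phi>"
    using surrounded_imp_interior by blast+
qed

lemma q_regular:
  "AE x in P. q x \<noteq> 0 \<and> q x \<in> interior (phi_dom \<phi>) \<and> left_end \<phi> < ereal (q x) \<and>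
     ereal (q x) < right_end \<phi> \<and> (\<psi> has_field_derivative slope x) (at (q x))"
  using q_dom q_nonzero
proof eventually_elim
  case (elim x)
  note i = nonzero_dom_imp_interior[OF elim]
  have "\<psi> differentiable (at (q x))"
    using diff i(2,3) by (simp add: phi_differentiable_def \<psi>_def[abs_def])
  then have "(\<psi> has_field_derivative slope x) (at (q x))"
    by (simp add: slope_def DERIV_deriv_iff_real_differentiable)
  with i elim show ?case by simp
qed

lemma perturbed_between:
  fixes h x :: real
  assumes "\<bar>h\<bar> \<le> \<delta>" "x \<in> phi_dom \<phi>"
  shows "x * (1 + h) \<in> phi_dom \<phi>" "\<psi> (x * (1 + h)) \<le> \<psi> ((1 - \<delta>) * x) + \<psi> ((1 + \<delta>) * x)"
proof -
  have m: "(1 - \<delta>) * x \<in> phi_dom \<phi>" "(1 + \<delta>) * x \<in> phi_dom \<phi>"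
    using delta assms(2) by (auto intro!: dilate_dom)
  show "x * (1 + h) \<in> phi_dom \<phi>"
    using dilate_dom[OF _ assms(2), of "1 + h"] assms(1) by (simp add: abs_le_iff mult.commute)
  show "\<psi> (x * (1 + h)) \<le> \<psi> ((1 - \<delta>) * x) + \<psi> ((1 + \<delta>) * x)"
  proof (cases "0 \<le> x")
    case True
    then have "(1 - \<delta>) * x \<le> x * (1 + h)" "x * (1 + h) \<le> (1 + \<delta>) * x"
      using assms(1) by (auto simp: mult.commute[of x] intro!: mult_right_mono)
    then show ?thesis using psi_le_sum[OF m] by blast
  next
    case False
    then have "(1 + \<delta>) * x \<le> x * (1 + h)" "x * (1 + h) \<le> (1 - \<delta>) * x"
      using assms(1) by (auto simp: mult.commute[of x] intro!: mult_right_mono_neg)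
    then show ?thesis using psi_le_sum[OF m(2,1)] by (simp add: add.commute)
  qed
qed

text \<open>
  An integrable bound, uniform in \<open>\<bar>h\<bar> \<le> \<delta>\<close>, for \<open>\<phi>(q (1 + h)) + \<phi>(q (1 - h))\<close>; each summand is
  at most the sum over the two extreme dilates, hence the factor 2.
\<close>

definition dominator :: "'a \<Rightarrow> real" where
  "dominator x = 2 * (\<psi> ((1 - \<delta>) * q x) + \<psi> ((1 + \<delta>) * q x))"

lemma dominator_int: "integrable P dominator"
  unfolding dominator_def[abs_def] using dilate_int[of "1 - \<delta>"] dilate_int[of "1 + \<delta>"] delta by simp

text \<open>
  Multiplicative perturbations of the density: if \<open>h\<close> is small and orthogonal to all \<open>q g\<^sub>j\<close>, the
  measure with density \<open>q (1 + h)\<close> satisfies the constraints and competes with the projection.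
\<close>

lemma perturbation_optimal:
  assumes h[measurable]: "h \<in> borel_measurable P" and bound: "\<And>x. \<bar>h x\<bar> \<le> \<delta>"
    and orth: "\<And>j. (LINT x|P. q x * gvec g x $ j * h x) = 0"
  shows "integrable P (\<lambda>x. \<psi> (q x * (1 + h x)))"
    and "(LINT x|P. \<psi> (q x)) \<le> (LINT x|P. \<psi> (q x * (1 + h x)))"
proof -
  let ?r = "\<lambda>x. q x * (1 + h x)"
  have qh: "integrable P (\<lambda>x. q x * h x)"
    by (rule integrable_mult_bounded[OF q_int h bound])
  have qgh: "integrable P (\<lambda>x. q x * gvec g x $ j * h x)" for j
    by (rule integrable_mult_bounded[OF q_moments(1) h bound])
  have r: "integrable P ?r" using q_int qh by (simp add: distrib_left)
  have rg: "?r x * gvec g x $ j = q x * gvec g x $ j + q x * gvec g x $ j * h x" for x j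
    by (simp add: algebra_simps)
  let ?R = "indefinite_integral P ?r"
  have R_ac: "?R \<in> ac_signed_measures P" by (rule indefinite_integral_ac[OF r])
  have R: "?R \<in> M_set P g"
    using M_set_iff_density[of g, OF g_meas R_ac r] q_moments qgh orth
    by (simp add: rg indefinite_integral_def)
  show int: "integrable P (\<lambda>x. \<psi> (?r x))"
  proof (rule Bochner_Integration.integrable_bound[OF dominator_int])
    show "AE x in P. norm (\<psi> (?r x)) \<le> norm (dominator x)"
      using q_dom
    proof eventually_elim
      case (elim x)
      show ?case
        using perturbed_between(2)[OF bound[of x] elim] psi_nonneg[of "?r x"] by (simp add: dominator_def)
    qed
  qed simp
  have "phi_divergence \<phi> P ?R = ereal (LINT x|P. \<psi> (?r x))"
    using R_ac unfolding phi_divergence_def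
  proof (simp, intro ereal_integral_eq_integral[OF int])
    show "AE x in P. \<phi> (signed_RN_deriv P ?R x) = ereal (\<psi> (?r x))"
      using q_dom indefinite_integral_RN_deriv[OF fin_P r]
    proof eventually_elim
      case (elim x)
      then show ?case using perturbed_between(1)[OF bound[of x] elim(1)] by (simp add: phi_eq_psi)
    qed
  qed
  then show "(LINT x|P. \<psi> (q x)) \<le> (LINT x|P. \<psi> (?r x))"
    using proj R divergence_Qs_eq by (auto simp: is_phi_projection_def)
qed

text \<open>
  The difference quotient with step \<open>1 / (n + 1)\<close> of the divergence integrand in the direction
  \<open>q h\<close>.
\<close>

definition quot :: "('a \<Rightarrow> real) \<Rightarrow> nat \<Rightarrow> 'a \<Rightarrow> real" where
  "quot h n x = (\<psi> (q x + 1 / real (Suc n) * (q x * h x)) - \<psi> (q x)) / (1 / real (Suc n))"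

lemma quot_limit: "AE x in P. (\<lambda>n. quot h n x) \<longlonglongrightarrow> slope x * (q x * h x)"
  using q_regular unfolding quot_def by eventually_elim (simp only: difference_quotient_LIMSEQ)

lemma quot_bound:
  assumes bound: "\<And>x. \<bar>h x\<bar> \<le> \<delta>"
  shows "AE x in P. \<forall>n. \<bar>quot h n x\<bar> \<le> dominator x"
  using q_regular q_dom
proof eventually_elim
  case (elim x)
  let ?k = "q x * h x"
  have plus: "q x + ?k \<in> phi_dom \<phi>" "\<psi> (q x + ?k) \<le> dominator x / 2"
    using perturbed_between[OF bound[of x] elim(2)] by (auto simp: dominator_def algebra_simps)
  have minus: "q x - ?k \<in> phi_dom \<phi>" "\<psi> (q x - ?k) \<le> dominator x / 2"
    using perturbed_between[OF _ elim(2), of "- h x"] bound[of x] by (auto simp: dominator_def algebra_simps)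
  show ?case
  proof
    fix n
    have "\<bar>quot h n x\<bar> \<le> \<psi> (q x + ?k) + \<psi> (q x - ?k)"
      unfolding quot_def
      using elim plus(1) minus(1) by (intro difference_quotient_bound) auto
    then show "\<bar>quot h n x\<bar> \<le> dominator x" using plus minus by linarith
  qed
qed

lemma quot_meas [measurable]:
  assumes [measurable]: "h \<in> borel_measurable P"
  shows "quot h n \<in> borel_measurable P"
  unfolding quot_def[abs_def] by measurable

text \<open>
  The function \<open>\<phi>'(q) q\<close> is almost everywhere a limit of measurable difference quotients in the
  direction \<open>\<delta> q\<close>.  Replacing it by that limit avoids any discussion of the measurability of
  the derivative.
\<close>

lemma slope_representative:
  obtains s where "s \<in> borel_measurable P" "AE x in P. s x = slope x * q x" "integrable P s"
proof -
  define s where "s x = lim (\<lambda>n. quot (\<lambda>_. \<delta>) n x) / \<delta>" for x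
  have s_meas: "s \<in> borel_measurable P" unfolding s_def[abs_def] by measurable
  have s_eq: "AE x in P. s x = slope x * q x"
    using quot_limit[of "\<lambda>_. \<delta>"]
  proof eventually_elim
    case (elim x)
    then show ?case using delta limI[OF elim] by (simp add: s_def)
  qed
  have "integrable P s"
  proof (rule Bochner_Integration.integrable_bound)
    show "integrable P (\<lambda>x. dominator x / \<delta>)" using dominator_int by simp
    have "AE x in P. \<forall>n. \<bar>quot (\<lambda>_. \<delta>) n x\<bar> \<le> dominator x"
      by (rule quot_bound) (use delta in simp)
    then show "AE x in P. norm (s x) \<le> norm (dominator x / \<delta>)"
      using quot_limit[of "\<lambda>_. \<delta>"] s_eq
    proof eventually_elim
      case (elim x)
      have "\<bar>slope x * (q x * \<delta>)\<bar> \<le> dominator x"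
        by (rule LIMSEQ_le_const2[OF tendsto_rabs[OF elim(2)]]) (use elim(1) in auto)
      then have "\<bar>slope x * q x\<bar> * \<delta> \<le> dominator x" using delta by (simp add: abs_mult mult.assoc)
      then have "\<bar>slope x * q x\<bar> \<le> dominator x / \<delta>" using delta by (simp add: field_simps)
      then have "\<bar>s x\<bar> \<le> dominator x / \<delta>" using elim(3) by simp
      also have "\<dots> \<le> norm (dominator x / \<delta>)" unfolding real_norm_def by (rule abs_ge_self)
      finally show ?case by (simp only: real_norm_def)
    qed
  qed (rule s_meas)
  with s_meas s_eq show ?thesis by (rule that)
qed

text \<open>
  First-order optimality: the difference quotients of the divergence are nonnegative and converge
  by dominated convergence.
\<close>

lemma first_order_condition_le:
  assumes s: "s \<in> borel_measurable P" "AE x in P. s x = slope x * q x"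
    and h[measurable]: "h \<in> borel_measurable P" and bound: "\<And>x. \<bar>h x\<bar> \<le> \<delta>"
    and orth: "\<And>j. (LINT x|P. q x * gvec g x $ j * h x) = 0"
  shows "0 \<le> (LINT x|P. s x * h x)"
proof (rule LIMSEQ_le_const)
  show "(\<lambda>n. LINT x|P. quot h n x) \<longlonglongrightarrow> (LINT x|P. s x * h x)"
  proof (rule integral_dominated_convergence[OF _ _ dominator_int])
    show "AE x in P. (\<lambda>n. quot h n x) \<longlonglongrightarrow> s x * h x"
      using quot_limit[of h] s(2) by eventually_elim (simp add: mult.assoc)
    show "AE x in P. norm (quot h n x) \<le> dominator x" for n
      using quot_bound[of h, OF bound] by eventually_elim simp
  qed (use s(1) in measurable)
  show "\<exists>N. \<forall>n\<ge>N. 0 \<le> (LINT x|P. quot h n x)"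
  proof (intro exI allI impI)
    fix n
    let ?h = "\<lambda>x. 1 / real (Suc n) * h x"
    have b: "\<bar>?h x\<bar> \<le> \<delta>" for x
    proof -
      have "\<bar>?h x\<bar> \<le> 1 * \<bar>h x\<bar>" unfolding abs_mult by (intro mult_right_mono) auto
      then show ?thesis using bound[of x] by simp
    qed
    have o: "(LINT x|P. q x * gvec g x $ j * ?h x) = 0" for j
    proof -
      have "(LINT x|P. q x * gvec g x $ j * ?h x) = (LINT x|P. 1 / real (Suc n) * (q x * gvec g x $ j * h x))"
        by (simp only: mult_ac)
      then show ?thesis using orth[of j] by simp
    qed
    have hm: "?h \<in> borel_measurable P" by simp
    have eq: "q x * (1 + ?h x) = q x + 1 / real (Suc n) * (q x * h x)" for x
      by (simp add: algebra_simps)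
    have "(LINT x|P. quot h n x)
        = ((LINT x|P. \<psi> (q x * (1 + ?h x))) - (LINT x|P. \<psi> (q x))) / (1 / real (Suc n))"
      unfolding quot_def eq[symmetric]
      using perturbation_optimal(1)[OF hm b o] psi_q_int by simp
    then show "0 \<le> (LINT x|P. quot h n x)"
      using perturbation_optimal(2)[OF hm b o] by simp
  qed
qed

text \<open>
  Admissible directions \<open>h\<close> form a linear space, so the inequality for \<open>h\<close> and \<open>- h\<close> becomes
  \<open>\<integral>\<phi>'(q) q h dP = 0\<close>, and \<open>\<phi>'(q) q\<close> is a combination of the \<open>q g\<^sub>j\<close>.  Full support allows
  division by \<open>q\<close>.
\<close>

lemma slope_in_span:
  obtains lb :: "real ^ 'l option" where "AE x in P. slope x = lb \<bullet> gvec g x"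
proof -
  obtain s where s: "s \<in> borel_measurable P" "AE x in P. s x = slope x * q x" "integrable P s"
    using slope_representative .
  have "\<exists>a :: real ^ 'l option. AE x in P. s x = (\<Sum>j\<in>UNIV. a $ j * (q x * gvec g x $ j))"
  proof (rule integrable_in_span_of_annihilator[OF s(3) q_moments(1)])
    fix h assume h: "h \<in> borel_measurable P" "\<And>x. \<bar>h x\<bar> \<le> (1::real)"
      and orth: "\<And>j. (LINT x|P. q x * gvec g x $ j * h x) = 0"
    have scaled: "0 \<le> (LINT x|P. s x * (c * h x))" if c: "\<bar>c\<bar> = \<delta>" for c
    proof (rule first_order_condition_le[OF s(1,2)])
      show "(\<lambda>x. c * h x) \<in> borel_measurable P" using h(1) by simp
      show "\<bar>c * h x\<bar> \<le> \<delta>" for x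
        using mult_left_mono[OF h(2)[of x], of \<delta>] c delta by (simp add: abs_mult)
      show "(LINT x|P. q x * gvec g x $ j * (c * h x)) = 0" for j
        using orth[of j] by (simp add: mult.left_commute)
    qed
    have "0 \<le> \<delta> * (LINT x|P. s x * h x)" "0 \<le> - \<delta> * (LINT x|P. s x * h x)"
      using scaled[of \<delta>] scaled[of "- \<delta>"] delta by (simp_all add: mult.left_commute)
    then show "(LINT x|P. s x * h x) = 0"
      using delta by (simp add: zero_le_mult_iff mult_le_0_iff)
  qed
  then obtain a :: "real ^ 'l option" where
    a: "AE x in P. s x = (\<Sum>j\<in>UNIV. a $ j * (q x * gvec g x $ j))" by blast
  have "AE x in P. slope x = a \<bullet> gvec g x"
    using a s(2) q_nonzero
  proof eventually_elim
    case (elim x)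
    have "slope x * q x = (a \<bullet> gvec g x) * q x"
      using elim(1,2) by (simp add: inner_gvec_sum sum_distrib_right sum_distrib_left mult_ac)
    then show ?case using elim(3) by simp
  qed
  then show ?thesis by (rule that)
qed

lemma phi_deriv_q: "AE x in P. phi_deriv \<phi> (q x) = ereal (slope x)"
  using q_regular by eventually_elim (auto simp: phi_deriv_def Let_def slope_def \<psi>_def[abs_def])


section \<open>Duality\<close>

text \<open>
  The minorant of \<open>\<phi>\<^sup>*(u\<^sup>T g)\<close> that Young's inequality gives at the point \<open>q\<close>.  Its integral is
  explicit because the moments of \<open>q\<close> are prescribed.
\<close>

definition young_bound :: "real ^ 'l option \<Rightarrow> 'a \<Rightarrow> real" where
  "young_bound u x = (u \<bullet> gvec g x) * q x - \<psi> (q x)"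

lemma young_bound_integral:
  "integrable P (young_bound u)" "(LINT x|P. young_bound u x) = u $ None - (LINT x|P. \<psi> (q x))"
proof -
  have eq: "(u \<bullet> gvec g x) * q x = (\<Sum>j\<in>UNIV. u $ j * (q x * gvec g x $ j))" for x
    by (simp add: inner_gvec_sum sum_distrib_right sum_distrib_left mult_ac)
  show "integrable P (young_bound u)"
    unfolding young_bound_def[abs_def] eq using q_moments(1) psi_q_int by simp
  show "(LINT x|P. young_bound u x) = u $ None - (LINT x|P. \<psi> (q x))"
    unfolding young_bound_def[abs_def] eq using q_moments psi_q_int by (simp add: option_sum)
qed

lemma young_bound_le: "AE x in P. ereal (young_bound u x) \<le> conjugate \<phi> (u \<bullet> gvec g x)"
  using q_dom
proof eventually_elim
  case (elim x)
  then show ?case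
    using conjugate_upper[of "u \<bullet> gvec g x" "q x" \<phi>] by (simp add: phi_eq_psi young_bound_def)
qed

lemma weak_duality: "dual_objective \<phi> P g u \<le> ereal (LINT x|P. \<psi> (q x))"
proof -
  have "dual_objective \<phi> P g u \<le> ereal (u $ None) - ereal (u $ None - (LINT x|P. \<psi> (q x)))"
    unfolding dual_objective_def
    using ereal_integral_ge_integral[OF young_bound_integral(1) young_bound_le, of u]
    by (intro ereal_minus_mono) (auto simp: young_bound_integral)
  then show ?thesis by simp
qed

lemma young_equality_iff:
  "AE x in P. conjugate \<phi> (u \<bullet> gvec g x) = ereal (young_bound u x) \<longleftrightarrow> u \<bullet> gvec g x = slope x"
  using q_regular
proof eventually_elim
  case (elim x)
  then have x: "q x \<in> interior (phi_dom \<phi>)" "(\<psi> has_field_derivative slope x) (at (q x))"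
    by simp_all
  show ?case
  proof
    assume "conjugate \<phi> (u \<bullet> gvec g x) = ereal (young_bound u x)"
    then show "u \<bullet> gvec g x = slope x"
      unfolding young_bound_def by (rule conjugate_equality_imp_derivative[OF x])
  next
    assume "u \<bullet> gvec g x = slope x"
    then show "conjugate \<phi> (u \<bullet> gvec g x) = ereal (young_bound u x)"
      using conjugate_at_derivative[OF x] by (simp only: young_bound_def)
  qed
qed

text \<open>
  The dual value of \<open>u\<close> equals the primal one exactly when Young's inequality is almost everywhere
  an equality at \<open>q\<close>, which by the description of its equality case means \<open>u\<^sup>T g = \<phi>'(q)\<close>.
  Existence and uniqueness of the dual optimum both follow from this equivalence.
\<close>

lemma dual_attained_iff:
  "dual_objective \<phi> P g u = ereal (LINT x|P. \<psi> (q x)) \<longleftrightarrow> (AE x in P. u \<bullet> gvec g x = slope x)"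
proof -
  let ?F = "\<lambda>x. conjugate \<phi> (u \<bullet> gvec g x)"
  have F_meas: "?F \<in> borel_measurable P"
    unfolding inner_gvec_sum by measurable
  have "dual_objective \<phi> P g u = ereal (LINT x|P. \<psi> (q x)) \<longleftrightarrow>
      ereal_integral P ?F = ereal (LINT x|P. young_bound u x)"
    unfolding dual_objective_def young_bound_integral
    by (cases "ereal_integral P ?F") auto
  also have "\<dots> \<longleftrightarrow> (AE x in P. ?F x = ereal (young_bound u x))"
    using ereal_integral_eq_imp_AE_eq[OF F_meas young_bound_integral(1) young_bound_le]
      ereal_integral_eq_integral[OF young_bound_integral(1), of ?F u] by (rule iffI)
  also have "\<dots> \<longleftrightarrow> (AE x in P. u \<bullet> gvec g x = slope x)"
    by (rule eventually_subst[OF young_equality_iff])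
  finally show ?thesis .
qed

end

theorem theorem5p1:
  fixes P :: "'a measure"
    and \<phi> :: "real \<Rightarrow> ereal"
    and g :: "'l::finite \<Rightarrow> 'a \<Rightarrow> real"
    and Qs :: "'a set \<Rightarrow> real"
  assumes P: "prob_space P"
    and phi: "divergence_function \<phi>"
    and g_meas: "\<And>i. g i \<in> borel_measurable P"
    and g_indep: "\<And>u :: real ^ 'l option. u \<noteq> 0 \<Longrightarrow>
                    measure P {x \<in> space P. u \<bullet> gvec g x \<noteq> 0} > 0"
    and growth: "\<exists>\<delta>::real. 0 < \<delta> \<and> \<delta> < 1 \<and>
                   (\<forall>c \<in> {1 - \<delta>..1 + \<delta>}. \<exists>c1 c2 c3 :: real. \<forall>x.
                      \<phi> (c * x) \<le> ereal c1 * \<phi> x + ereal (c2 * \<bar>x\<bar> + c3))"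
    and diff: "phi_differentiable \<phi>"
    and proj: "is_phi_projection \<phi> P (M_set P g) Qs"
    and supp: "same_support P Qs"
  shows "\<exists>lb :: real ^ 'l option.
           (AE x in P. phi_deriv \<phi> (signed_RN_deriv P Qs x)
                         = ereal (lb $ None + (\<Sum>i\<in>UNIV. lb $ Some i * g i x))) \<and>
           (INF Q \<in> M_set P g. phi_divergence \<phi> P Q)
             = (SUP u :: real ^ 'l option. dual_objective \<phi> P g u) \<and>
           dual_optimal \<phi> P g lb \<and>
           (essentially_smooth \<phi> \<longrightarrow> (\<forall>v. dual_optimal \<phi> P g v \<longrightarrow> v = lb))"
proof -
  obtain \<delta> :: real where delta: "0 < \<delta>" "\<delta> < 1"
    and growth': "\<And>c. c \<in> {1 - \<delta>..1 + \<delta>} \<Longrightarrow> \<exists>c1 c2 c3 :: real. \<forall>x.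
                      \<phi> (c * x) \<le> ereal c1 * \<phi> x + ereal (c2 * \<bar>x\<bar> + c3)"
    using growth by blast
  interpret prob_space P by (rule P)
  interpret supported_projection \<phi> P g Qs \<delta>
    by unfold_locales (fact phi g_meas delta growth' diff proj supp)+
  obtain lb :: "real ^ 'l option" where lb: "AE x in P. slope x = lb \<bullet> gvec g x"
    using slope_in_span .
  have attained: "dual_objective \<phi> P g lb = ereal (LINT x|P. \<psi> (q x))"
    using lb unfolding dual_attained_iff by eventually_elim simp
  have sup: "(SUP u :: real ^ 'l option. dual_objective \<phi> P g u) = ereal (LINT x|P. \<psi> (q x))"
    by (rule antisym) (auto intro: SUP_least weak_duality SUP_upper2[of lb] simp: attained)
  have "v = lb" if "dual_optimal \<phi> P g v" for v
  proof (rule ccontr)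
    assume "v \<noteq> lb"
    have "AE x in P. v \<bullet> gvec g x = slope x"
      using that sup by (simp add: dual_optimal_def dual_attained_iff[symmetric])
    with lb have "AE x in P. \<not> (v - lb) \<bullet> gvec g x \<noteq> 0"
      by eventually_elim (simp add: inner_diff_left)
    then have "measure P {x \<in> space P. (v - lb) \<bullet> gvec g x \<noteq> 0} = 0"
      by (rule prob_eq_0_AE)
    with g_indep[of "v - lb"] \<open>v \<noteq> lb\<close> show False by simp
  qed
  moreover have "AE x in P. phi_deriv \<phi> (signed_RN_deriv P Qs x)
      = ereal (lb $ None + (\<Sum>i\<in>UNIV. lb $ Some i * g i x))"
    using phi_deriv_q lb unfolding q_def[symmetric] by eventually_elim (simp add: inner_gvec)
  moreover have "dual_optimal \<phi> P g lb"
    using attained sup by (simp add: dual_optimal_def)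
  moreover have "(INF Q \<in> M_set P g. phi_divergence \<phi> P Q)
      = (SUP u :: real ^ 'l option. dual_objective \<phi> P g u)"
    using divergence_Qs_eq_INF divergence_Qs_eq sup by simp
  ultimately show ?thesis by blast
qed

end
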